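(* In the variable-assignment setting, suppose that $\mathcal B$ satisfies Shearer's criterion. Let $\mathcal A=\{A_1,\dots,A_m\}$ be a finite nonempty set of events in the probability space $\Omega$, and let $\vee\mathcal A=A_1\cup\dots\cup A_m$. Then $$\Pr_{\mathrm{MT}}(\vee\mathcal A)\ \le\ \Pr_\Omega(\vee\mathcal A)\cdot\max_{A\in\mathcal A}\Psi_{\mathcal B[\vee\mathcal A]}(A).$$
   Context: Variable-assignment setting: $\Omega$ is a product probability space with independent random variables $X(1),\dots,X(n)$. Every event $E$ considered is a boolean function of the variables in a specified subset $\mathrm{var}(E)\subseteq\{1,\dots,n\}$, and $E\sim E'$ means $\mathrm{var}(E)\cap\mathrm{var}(E')\ne\emptyset$. $\mathcal B$ is a finite collection of events (the bad-events). For an event $E$, $N(E)=\{B\in\mathcal B: B\sim E\}$ (for $B\in\mathcal B$ this is the inclusive neighborhood, so $B\in N(B)$). A set $I\subseteq\mathcal B$ is stable if no two distinct $B,B'\in I$ satisfy $B\sim B'$. For a subfamily $\mathcal C\subseteq\mathcal B$ and $I\subseteq\mathcal C$ let $$Q_{\mathcal C}(I)=\sum_{I\subseteq J\subseteq\mathcal C,\ J\text{ stable}}(-1)^{|J|-|I|}\prod_{B\in J}\Pr_\Omega(B).$$ Shearer's criterion for $\mathcal B$: $Q_{\mathcal B}(I)>0$ for all stable $I\subseteq\mathcal B$. (It is then also satisfied by every subfamily.) Under it, $\mu_{\mathcal C}(I)=Q_{\mathcal C}(I)/Q_{\mathcal C}(\emptyset)$ and, for an event $E$, $\Psi_{\mathcal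 C}(E)=\sum_{J\subseteq N(E)\cap\mathcal C}\mu_{\mathcal C}(J)$. For an event $E$, $\mathcal B[E]$ is the set of $B\in\mathcal B$ with $\Pr_\Omega(E\mid B)<1$. MT (Moser–Tardos) algorithm: draw $X\sim\Omega$; while some $B\in\mathcal B$ is true on $X$, choose some true $B\in\mathcal B$ (by an arbitrary fixed, possibly randomized, rule) and resample all variables in $\mathrm{var}(B)$ independently from their distributions in $\Omega$. Under Shearer's criterion it terminates with probability one. $\Pr_{\mathrm{MT}}$ denotes probability with respect to the distribution of $X$ at termination; the result holds for every choice of selection rule. *)

theory Defs
  imports "HOL-Probability.Probability"
begin

text \<open>
  A configuration assigns a value to each of the variables \<open>1, \<dots>, n\<close>. Given the laws \<open>M i\<close> of the
  individual variables, \<open>\<Omega>\<close> is the product space \<^term>\<open>prod_space n M\<close>, whose coordinates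
  are the independent variables \<open>X(1), \<dots>, X(n)\<close>. All value spaces share the type \<^typ>\<open>'a\<close>, but the
  measurable spaces \<open>M i\<close> on it may differ.
\<close>

type_synonym 'a config = "nat \<Rightarrow> 'a"

definition prod_space :: "nat \<Rightarrow> (nat \<Rightarrow> 'a measure) \<Rightarrow> 'a config measure" where
  "prod_space n M = PiM {1..n} M"

text \<open>The specified variable set is part of the data of an event and need not be minimal.\<close>

datatype 'a event = Event (var: "nat set") (holds: "'a config set")

definition is_event :: "nat \<Rightarrow> (nat \<Rightarrow> 'a measure) \<Rightarrow> 'a event \<Rightarrow> bool" where
  "is_event n M E \<longleftrightarrow>
     var E \<subseteq> {1..n} \<and>
     holds E \<in> sets (prod_space n M) \<and>
     (\<forall>x\<in>space (prod_space n M). \<forall>y\<in>space (prod_space n M).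
        (\<forall>i\<in>var E. x i = y i) \<longrightarrow> (x \<in> holds E \<longleftrightarrow> y \<in> holds E))"

definition related :: "'a event \<Rightarrow> 'a event \<Rightarrow> bool" where
  "related E E' \<longleftrightarrow> var E \<inter> var E' \<noteq> {}"

definition nbhd :: "'a event set \<Rightarrow> 'a event \<Rightarrow> 'a event set" where
  "nbhd \<C> E = {B \<in> \<C>. related B E}"

definition stable :: "'a event set \<Rightarrow> bool" where
  "stable I \<longleftrightarrow> (\<forall>B\<in>I. \<forall>B'\<in>I. B \<noteq> B' \<longrightarrow> \<not> related B B')"

definition Q :: "'a config measure \<Rightarrow> 'a event set \<Rightarrow> 'a event set \<Rightarrow> real" where
  "Q \<Omega> \<C> I =
     (\<Sum>J | I \<subseteq> J \<and> J \<subseteq> \<C> \<and> stable J.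
        (- 1) ^ (card J - card I) * (\<Prod>B\<in>J. measure \<Omega> (holds B)))"

text \<open>
  Taking \<open>I = {B}\<close> shows that the criterion forces every bad-event to have positive probability,
  so the conditional probabilities in \<open>bad_cond\<close> below are never divisions by zero.
\<close>

definition shearer :: "'a config measure \<Rightarrow> 'a event set \<Rightarrow> bool" where
  "shearer \<Omega> \<B> \<longleftrightarrow> (\<forall>I. I \<subseteq> \<B> \<and> stable I \<longrightarrow> Q \<Omega> \<B> I > 0)"

definition \<mu> :: "'a config measure \<Rightarrow> 'a event set \<Rightarrow> 'a event set \<Rightarrow> real" where
  "\<mu> \<Omega> \<C> I = Q \<Omega> \<C> I / Q \<Omega> \<C> {}"

text \<open>For \<open>\<C> \<subseteq> \<B>\<close>, the set \<open>nbhd \<C> E\<close> is \<open>N(E) \<inter> \<C>\<close>.\<close>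

definition \<Psi> :: "'a config measure \<Rightarrow> 'a event set \<Rightarrow> 'a event \<Rightarrow> real" where
  "\<Psi> \<Omega> \<C> E = (\<Sum>J | J \<subseteq> nbhd \<C> E. \<mu> \<Omega> \<C> J)"

text \<open>The subfamily \<open>\<B>[E]\<close>; it depends only on the set of outcomes \<open>E\<close>.\<close>

definition bad_cond :: "'a config measure \<Rightarrow> 'a event set \<Rightarrow> 'a config set \<Rightarrow> 'a event set" where
  "bad_cond \<Omega> \<B> E = {B \<in> \<B>. cond_prob \<Omega> (\<lambda>x. x \<in> E) (\<lambda>x. x \<in> holds B) < 1}"

text \<open>
  The Moser-Tardos algorithm. A selection rule \<open>sel s t h\<close> sees the time \<open>t\<close>, the whole history
  \<open>h 0, \<dots>, h t\<close> of configurations so far (a function on \<open>{..t}\<close>), and a random seed \<open>s\<close>, drawn from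
  an arbitrary probability space \<open>S\<close> independently of all samples of variables. The events
  selected earlier are determined by \<open>s\<close> and \<open>h\<close>, so the rule may also depend on them. The value
  of the rule only matters when some bad-event is true on the current configuration \<open>h t\<close>.
\<close>

type_synonym ('s, 'a) rule = "'s \<Rightarrow> nat \<Rightarrow> (nat \<Rightarrow> 'a config) \<Rightarrow> 'a event"

definition selection_rule ::
  "'a config measure \<Rightarrow> 'a event set \<Rightarrow> 's measure \<Rightarrow> ('s, 'a) rule \<Rightarrow> bool" where
  "selection_rule \<Omega> \<B> S sel \<longleftrightarrow>
     (\<forall>t. \<forall>s\<in>space S. \<forall>h\<in>space (PiM {..t} (\<lambda>_. \<Omega>)).
        (\<exists>B\<in>\<B>. h t \<in> holds B) \<longrightarrow> sel s t h \<in> \<B> \<and> h t \<in> holds (sel s t h)) \<and>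
     (\<forall>t. \<forall>B\<in>\<B>.
        {p \<in> space (S \<Otimes>\<^sub>M PiM {..t} (\<lambda>_. \<Omega>)). sel (fst p) t (snd p) = B}
          \<in> sets (S \<Otimes>\<^sub>M PiM {..t} (\<lambda>_. \<Omega>)))"

definition resample :: "'a event \<Rightarrow> 'a config \<Rightarrow> 'a config \<Rightarrow> 'a config" where
  "resample B y x = (\<lambda>i. if i \<in> var B then y i else x i)"

text \<open>
  \<open>Y 0, Y 1, \<dots>\<close> are independent samples of \<open>\<Omega>\<close>: \<open>Y 0\<close> is the initial configuration, and
  \<open>Y (Suc t)\<close> supplies the fresh values of the variables resampled in step \<open>t\<close> (its other
  coordinates are discarded). Once no bad-event is true the configuration stays constant.
\<close>

primrec mt_history ::
  "'a event set \<Rightarrow> ('s, 'a) rule \<Rightarrow> (nat \<Rightarrow> 'a config) \<Rightarrow> 's \<Rightarrow> nat \<Rightarrow> nat \<Rightarrow> 'a config" where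
  "mt_history \<B> sel Y s 0 = (\<lambda>k\<in>{..0}. Y 0)"
| "mt_history \<B> sel Y s (Suc t) =
     (let h = mt_history \<B> sel Y s t
      in h(Suc t := if \<exists>B\<in>\<B>. h t \<in> holds B
                    then resample (sel s t h) (Y (Suc t)) (h t)
                    else h t))"

definition mt_state ::
  "'a event set \<Rightarrow> ('s, 'a) rule \<Rightarrow> (nat \<Rightarrow> 'a config) \<Rightarrow> 's \<Rightarrow> nat \<Rightarrow> 'a config" where
  "mt_state \<B> sel Y s t = mt_history \<B> sel Y s t t"

definition mt_space :: "'a config measure \<Rightarrow> 's measure \<Rightarrow> ((nat \<Rightarrow> 'a config) \<times> 's) measure" where
  "mt_space \<Omega> S = PiM (UNIV :: nat set) (\<lambda>_. \<Omega>) \<Otimes>\<^sub>M S"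

text \<open>
  The probability that the algorithm terminates with a configuration in \<open>E\<close>. Under Shearer's
  criterion termination has probability one, and this is the probability of \<open>E\<close> under the
  distribution of the configuration at termination.
\<close>

definition mt_prob ::
  "'a config measure \<Rightarrow> 'a event set \<Rightarrow> 's measure \<Rightarrow> ('s, 'a) rule \<Rightarrow> 'a config set \<Rightarrow> real" where
  "mt_prob \<Omega> \<B> S sel E =
     measure (mt_space \<Omega> S)
       {p \<in> space (mt_space \<Omega> S).
          \<exists>t. (\<forall>B\<in>\<B>. mt_state \<B> sel (fst p) (snd p) t \<notin> holds B) \<and>
              mt_state \<B> sel (fst p) (snd p) t \<in> E}"

end

theory Submission
  imports Defs
begin

text \<open>
  Let \<open>E\<close> be the union of the targets. Up to a null event, a bad-event resampled before the first
  visit to \<open>E\<close> lies in \<open>\<B>[E]\<close>, because a bad-event with \<open>Pr(E | B) = 1\<close> is almost never true outside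
  \<open>E\<close>. Regard the run up to that visit as a trace (commuting resamplings of unrelated events) and
  choose a minimal prefix of it after which \<open>E\<close> holds. If a target \<open>A\<close> holds after the minimal prefix,
  then each resampling that can be moved to its end is related to \<open>A\<close>. The trace of the word \<open>L\<close> occurs
  as a prefix of the run and leads into a given set \<open>F\<close> with probability at most
  \<open>(\<Prod>B\<leftarrow>L. Pr B) * Pr F\<close>, and the weights of all traces whose last events are related to \<open>A\<close> sum to
  at most \<open>\<Psi> A\<close>. Splitting \<open>E\<close> according to the first target that holds gives the maximum of \<open>\<Psi> A\<close>
  instead of a sum over the targets.
\<close>

subsection \<open>The independence polynomial\<close>

lemma related_commute: "related B C \<longleftrightarrow> related C B"
  by (auto simp: related_def)

text \<open>The stable sets containing \<open>B\<close> are the sets \<open>insert B J\<close> with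
  \<open>J\<close> stable and free of neighbours of \<open>B\<close>; adding \<open>B\<close> flips
  the sign and contributes its probability. This is the deletion recurrence of the independence
  polynomial.\<close>

lemma Q_empty_insert:
  assumes "finite X" "B \<notin> X"
  shows "Q \<Omega> (insert B X) {} = Q \<Omega> X {} - measure \<Omega> (holds B) * Q \<Omega> (X - nbhd X B) {}"
proof -
  let ?w = "\<lambda>J. (- 1) ^ card J * (\<Prod>C\<in>J. measure \<Omega> (holds C))"
  let ?X = "{J. J \<subseteq> X \<and> stable J}" and ?Y = "{J. J \<subseteq> X - nbhd X B \<and> stable J}"
  have fin: "finite ?X" "finite ?Y"
    using assms(1) by (auto intro: finite_subset[OF _ finite_Pow_iff[THEN iffD2, OF assms(1)]])
  have split: "{J. J \<subseteq> insert B X \<and> stable J} = ?X \<union> insert B ` ?Y"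
  proof (intro equalityI subsetI)
    fix J assume J: "J \<in> {J. J \<subseteq> insert B X \<and> stable J}"
    show "J \<in> ?X \<union> insert B ` ?Y"
    proof (cases "B \<in> J")
      case True
      have "J - {B} \<in> ?Y"
        using J True by (fastforce simp: stable_def nbhd_def)
      moreover have "J = insert B (J - {B})" using True by auto
      ultimately show ?thesis by blast
    next
      case False
      then show ?thesis using J by auto
    qed
  next
    fix J assume "J \<in> ?X \<union> insert B ` ?Y"
    then show "J \<in> {J. J \<subseteq> insert B X \<and> stable J}"
      by (fastforce simp: stable_def nbhd_def related_def)
  qed
  have inj: "inj_on (insert B) ?Y"
    using assms(2) by (auto simp: inj_on_def)
  have "sum ?w (insert B ` ?Y) = (\<Sum>J\<in>?Y. - measure \<Omega> (holds B) * ?w J)"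
  proof (subst sum.reindex[OF inj], rule sum.cong[OF refl])
    fix J assume J: "J \<in> ?Y"
    then have "finite J" "B \<notin> J"
      using assms finite_subset[of J X] by auto
    then show "(?w \<circ> insert B) J = - measure \<Omega> (holds B) * ?w J" by simp
  qed
  moreover have "?X \<inter> insert B ` ?Y = {}"
    using assms(2) by auto
  ultimately show ?thesis
    using fin by (simp add: Q_def split sum.union_disjoint sum_distrib_left sum_negf)
qed

lemma Q_empty_insert_le:
  assumes "finite X" "B \<notin> X" "Q \<Omega> (X - nbhd X B) {} \<ge> 0"
  shows "Q \<Omega> (insert B X) {} \<le> Q \<Omega> X {}"
  using Q_empty_insert[OF assms(1,2)] assms(3) by simp

lemma Q_unstable: "\<not> stable I \<Longrightarrow> Q \<Omega> C I = 0"
proof -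
  assume "\<not> stable I"
  then have none: "{J. I \<subseteq> J \<and> J \<subseteq> C \<and> stable J} = {}" by (auto simp: stable_def)
  show ?thesis unfolding Q_def none by simp
qed

text \<open>Inclusion-exclusion: once the sums are exchanged, a stable \<open>J\<close> carries the
  alternating sum over the subsets of \<open>J \<inter> T\<close>, so only the \<open>J\<close>
  disjoint from \<open>T\<close> survive.\<close>

lemma sum_Q_subsets:
  assumes "finite C" "T \<subseteq> C"
  shows "(\<Sum>K | K \<subseteq> T. Q \<Omega> C K) = Q \<Omega> (C - T) {}"
proof -
  let ?St = "{J. J \<subseteq> C \<and> stable J}"
  let ?p = "\<lambda>J. \<Prod>B\<in>J. measure \<Omega> (holds B)"
  have fin: "finite T" "finite ?St"
    using assms finite_subset by auto
  have finJ: "finite J" if "J \<in> ?St" for J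
    using that assms(1) finite_subset by auto
  have "(\<Sum>K | K \<subseteq> T. Q \<Omega> C K) =
      (\<Sum>K | K \<subseteq> T. \<Sum>J\<in>?St. if K \<subseteq> J then (- 1) ^ (card J - card K) * ?p J else 0)"
    unfolding Q_def using fin(2)
    by (intro sum.cong[OF refl] sum.mono_neutral_cong_left) auto
  also have "\<dots> = (\<Sum>J\<in>?St. \<Sum>K | K \<subseteq> T. if K \<subseteq> J then (- 1) ^ (card J - card K) * ?p J else 0)"
    by (rule sum.swap)
  also have "\<dots> = (\<Sum>J\<in>?St. if J \<inter> T = {} then (- 1) ^ card J * ?p J else 0)"
  proof (rule sum.cong[OF refl])
    fix J assume J: "J \<in> ?St"
    have "(\<Sum>K | K \<subseteq> T. if K \<subseteq> J then (- 1) ^ (card J - card K) * ?p J else 0) =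
        (\<Sum>K\<in>Pow (J \<inter> T). (- 1) ^ (card J - card K) * ?p J)"
      using fin(1) by (intro sum.mono_neutral_cong_right) auto
    also have "\<dots> = (\<Sum>K\<in>Pow (J \<inter> T). (- 1) ^ card J * ?p J * (- 1) ^ card K)"
    proof (rule sum.cong[OF refl])
      fix K assume "K \<in> Pow (J \<inter> T)"
      then have "card K \<le> card J" using finJ[OF J] by (auto intro: card_mono)
      then have "card J = card J - card K + card K" by simp
      then have "(- 1 :: real) ^ card J * (- 1) ^ card K = (- 1) ^ (card J - card K) * ((- 1) ^ card K * (- 1) ^ card K)"
        by (metis power_add mult.assoc)
      then show "(- 1) ^ (card J - card K) * ?p J = (- 1) ^ card J * ?p J * (- 1) ^ card K"
        by (simp add: mult.assoc mult.commute[of "?p J"] flip: power_mult_distrib)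
    qed
    also have "\<dots> = (- 1) ^ card J * ?p J * (\<Sum>K\<in>Pow (J \<inter> T). (- 1) ^ card K)"
      by (simp add: sum_distrib_left)
    \<comment> \<open>This is the expansion of the product of the factors \<open>1 - 1\<close> over
      \<open>J \<inter> T\<close>.\<close>
    also have "(\<Sum>K\<in>Pow (J \<inter> T). (- 1 :: real) ^ card K) = (if J \<inter> T = {} then 1 else 0)"
      using prod_diff_conv_sum[of "J \<inter> T" "\<lambda>_. 1 :: real" "\<lambda>_. 1"] finJ[OF J]
      by (simp add: card_eq_0_iff power_0_left del: Pow_Int_eq)
    finally show "(\<Sum>K | K \<subseteq> T. if K \<subseteq> J then (- 1) ^ (card J - card K) * ?p J else 0) =
        (if J \<inter> T = {} then (- 1) ^ card J * ?p J else 0)" by (simp split: if_splits)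
  qed
  also have "\<dots> = Q \<Omega> (C - T) {}"
    unfolding Q_def using fin(2)
    by (intro sum.mono_neutral_cong_right) auto
  finally show ?thesis .
qed

text \<open>\<open>sum_Q_subsets\<close> with \<open>T = \<B> - C\<close> expresses the value
  through terms \<open>Q \<Omega> \<B> K\<close>. These are nonnegative, being 0 for unstable
  \<open>K\<close>, and the term for \<open>K = {}\<close> is positive.\<close>

lemma shearer_Q_pos:
  assumes "finite \<B>" "shearer \<Omega> \<B>" "C \<subseteq> \<B>"
  shows "Q \<Omega> C {} > 0"
proof -
  have nonneg: "Q \<Omega> \<B> K \<ge> 0" if "K \<subseteq> \<B>" for K
    using assms(2) that Q_unstable[of K \<Omega> \<B>] by (cases "stable K") (auto simp: shearer_def less_imp_le)
  have "0 < Q \<Omega> \<B> {}"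
    using assms(2) by (simp add: shearer_def stable_def)
  also have "\<dots> \<le> (\<Sum>K | K \<subseteq> \<B> - C. Q \<Omega> \<B> K)"
    using assms(1) nonneg by (intro member_le_sum) auto
  also have "\<dots> = Q \<Omega> C {}"
    using assms by (simp add: sum_Q_subsets double_diff)
  finally show ?thesis .
qed

text \<open>The events of \<open>C - D\<close> are added one at a time; by
  \<open>shearer_Q_pos\<close> each application of the recurrence subtracts a nonnegative
  quantity.\<close>

lemma shearer_Q_antimono:
  assumes "finite \<B>" "shearer \<Omega> \<B>" "D \<subseteq> C" "C \<subseteq> \<B>"
  shows "Q \<Omega> C {} \<le> Q \<Omega> D {}"
proof -
  have "finite (C - D)" using assms finite_subset by blast
  moreover have "X \<subseteq> C - D \<Longrightarrow> Q \<Omega> (D \<union> X) {} \<le> Q \<Omega> D {}" if "finite X" for X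
    using that
  proof (induction X rule: finite_induct)
    case (insert B X)
    have "Q \<Omega> (insert B (D \<union> X)) {} \<le> Q \<Omega> (D \<union> X) {}"
      using insert assms finite_subset[of _ \<B>]
      by (intro Q_empty_insert_le less_imp_le[OF shearer_Q_pos[OF assms(1,2)]]) auto
    then show ?case using insert by simp
  qed simp
  ultimately have "Q \<Omega> (D \<union> (C - D)) {} \<le> Q \<Omega> D {}" by blast
  then show ?thesis using assms(3) by (simp add: Un_absorb1)
qed

text \<open>Brings \<open>\<Psi>\<close> into the form of the ratio that bounds the total weight of
  traces.\<close>

lemma shearer_Psi_eq:
  assumes "finite C"
  shows "\<Psi> \<Omega> C A = Q \<Omega> (C - nbhd C A) {} / Q \<Omega> C {}"
proof -
  have "nbhd C A \<subseteq> C" by (auto simp: nbhd_def)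
  from sum_Q_subsets[OF assms this, symmetric] show ?thesis
    by (simp add: \<Psi>_def \<mu>_def sum_divide_distrib)
qed

lemma related_self: "related B B \<longleftrightarrow> var B \<noteq> {}"
  by (simp add: related_def)

text \<open>With no variables, \<open>B\<close> would be impossible or certain. In the first case
  \<open>Q \<Omega> \<B> {B}\<close> vanishes, in the second \<open>Q \<Omega> {B} {}\<close> does,
  and both must be positive.\<close>

lemma shearer_related_self:
  assumes "finite \<B>" "shearer \<Omega> \<B>" "prob_space \<Omega>" "B \<in> \<B>"
    "holds B \<in> sets \<Omega>"
    "\<And>x y. \<lbrakk>x \<in> space \<Omega>; y \<in> space \<Omega>; \<forall>i\<in>var B. x i = y i\<rbrakk> \<Longrightarrow> x \<in> holds B \<longleftrightarrow> y \<in> holds B"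
  shows "related B B"
proof (rule ccontr)
  interpret prob_space \<Omega> by fact
  assume "\<not> related B B"
  then have var: "var B = {}" by (simp add: related_self)
  have "holds B = space \<Omega>" if "x \<in> holds B" for x
    using assms(6)[of x] sets.sets_into_space[OF assms(5)] that var by blast
  then consider "holds B = {}" | "holds B = space \<Omega>" by blast
  then show False
  proof cases
    case 1
    have "Q \<Omega> \<B> {B} = 0"
      unfolding Q_def using 1 assms(1) finite_subset[of _ \<B>]
      by (intro sum.neutral ballI) (auto intro!: bexI[of _ B])
    moreover have "Q \<Omega> \<B> {B} > 0"
      using assms(2,4) by (simp add: shearer_def stable_def)
    ultimately show False by simp
  next
    case 2
    have "Q \<Omega> {B} {} = 0"
      using Q_empty_insert[of "{}" B \<Omega>] 2 by (simp add: prob_space)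
    then show False using shearer_Q_pos[OF assms(1,2), of "{B}"] assms(4) by simp
  qed
qed

subsection \<open>Traces of resamplings\<close>

text \<open>Mazurkiewicz trace equivalence. An entry pairs an event with the sample used to resample
  it, so that each sample travels with its event.\<close>

inductive trace_eq :: "('a event \<times> 'b) list \<Rightarrow> ('a event \<times> 'b) list \<Rightarrow> bool" where
  refl: "trace_eq W W"
| swap: "trace_eq W (U @ p # q # V) \<Longrightarrow> \<not> related (fst p) (fst q) \<Longrightarrow> fst p \<noteq> fst q \<Longrightarrow>
    trace_eq W (U @ q # p # V)"

lemma trace_eq_trans: "trace_eq V W \<Longrightarrow> trace_eq U V \<Longrightarrow> trace_eq U W"
  by (induction V W rule: trace_eq.induct) (auto intro: trace_eq.swap)

lemma trace_eq_append: "trace_eq W W' \<Longrightarrow> trace_eq (W @ V) (W' @ V)"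
proof (induction W W' rule: trace_eq.induct)
  case (swap W U p q V')
  then show ?case using trace_eq.swap[of "W @ V" U p q "V' @ V"] by simp
qed (rule trace_eq.refl)

lemma trace_eq_length: "trace_eq W W' \<Longrightarrow> length W' = length W"
  by (induction W W' rule: trace_eq.induct) auto

lemma trace_eq_set: "trace_eq W W' \<Longrightarrow> set W' = set W"
  by (induction W W' rule: trace_eq.induct) auto

text \<open>The common reason why both \<open>exec\<close> and \<open>track\<close> are invariants
  of the trace.\<close>

lemma trace_eq_foldl:
  assumes "trace_eq W W'"
    and "\<And>s p q. \<lbrakk>\<not> related (fst p) (fst q); fst p \<noteq> fst q\<rbrakk> \<Longrightarrow> f (f s p) q = f (f s q) p"
  shows "foldl f s W = foldl f s W'"
  using assms(1)
proof (induction W W' rule: trace_eq.induct)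
  case (swap W U p q V)
  then show ?case using assms(2)[of p q "foldl f s U"] by simp
qed simp

section \<open>Executing a log and reading it against a fixed word\<close>

definition exec :: "'a config \<Rightarrow> ('a event \<times> 'a config) list \<Rightarrow> 'a config" where
  "exec = foldl (\<lambda>x (B, y). resample B y x)"

lemma exec_simps [simp]:
  "exec x [] = x"
  "exec x (W @ [(B, y)]) = resample B y (exec x W)"
  by (simp_all add: exec_def)

lemma resample_commute:
  "\<not> related B C \<Longrightarrow> resample B y (resample C y' x) = resample C y' (resample B y x)"
  by (auto simp: resample_def related_def fun_eq_iff)

lemma trace_eq_exec: "trace_eq W W' \<Longrightarrow> exec x W' = exec x W"
  unfolding exec_def
  by (rule trace_eq_foldl[symmetric]) (auto simp: resample_commute related_commute split: prod.split)

text \<open>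
  \<^term>\<open>take_source B L\<close> cancels \<open>B\<close> if it can be moved to the front of the trace of \<open>L\<close>, leaves \<open>L\<close>
  unchanged if \<open>B\<close> commutes with all of it, and fails if \<open>B\<close> cannot be executed before the rest of \<open>L\<close>.
\<close>

fun take_source :: "'a event \<Rightarrow> 'a event list \<Rightarrow> 'a event list option" where
  "take_source B [] = Some []"
| "take_source B (C # L) =
    (if B = C then Some L else if related B C then None else map_option ((#) C) (take_source B L))"

lemma take_source_notin: "take_source B L = Some L' \<Longrightarrow> B \<notin> set L \<Longrightarrow> L' = L"
  by (induction L arbitrary: L') (auto split: if_splits)

lemma take_source_notin_related: "take_source B L = Some L' \<Longrightarrow> B \<notin> set L \<Longrightarrow> C \<in> set L \<Longrightarrow> \<not> related B C"
  by (induction L arbitrary: L') (auto split: if_splits)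

lemma take_source_subset: "take_source B L = Some L' \<Longrightarrow> set L' \<subseteq> set L"
  by (induction L arbitrary: L') (auto split: if_splits)

lemma take_source_in_iff: "take_source B L = Some L' \<Longrightarrow> C \<noteq> B \<Longrightarrow> C \<in> set L' \<longleftrightarrow> C \<in> set L"
  by (induction L arbitrary: L') (auto split: if_splits)

lemma take_source_commute:
  "\<not> related B C \<Longrightarrow> B \<noteq> C \<Longrightarrow> Option.bind (take_source B L) (take_source C) = Option.bind (take_source C L) (take_source B)"
proof (induction L)
  case (Cons D L)
  then show ?case
    by (cases "take_source B L"; cases "take_source C L") (auto simp: related_commute)
qed simp

text \<open>
  The state \<open>(L, z)\<close> consists of the part of the prefix still to be executed and the configuration
  reached by executing, with the samples of the run, only the part already executed.
\<close>

fun consume :: "('a event list \<times> 'a config) option \<Rightarrow> 'a event \<times> 'a config \<Rightarrow>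
    ('a event list \<times> 'a config) option" where
  "consume None _ = None"
| "consume (Some (L, z)) (B, y) =
    map_option (\<lambda>L'. (L', if B \<in> set L then resample B y z else z)) (take_source B L)"

definition track :: "'a event list \<Rightarrow> 'a config \<Rightarrow> ('a event \<times> 'a config) list \<Rightarrow>
    ('a event list \<times> 'a config) option" where
  "track L x = foldl consume (Some (L, x))"

lemma track_simps [simp]:
  "track L x [] = Some (L, x)"
  "track L x (W @ [p]) = consume (track L x W) p"
  by (simp_all add: track_def)

lemma consume_commute:
  assumes "\<not> related B C" "B \<noteq> C"
  shows "consume (consume s (B, y)) (C, y') = consume (consume s (C, y')) (B, y)"
proof (cases s)
  case (Some a)
  obtain L z where a: "a = (L, z)" by fastforce
  show ?thesis
    using take_source_commute[OF assms, of L] assms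
    by (cases "take_source B L"; cases "take_source C L")
      (auto simp: Some a take_source_in_iff resample_commute[OF assms(1)] Option.bind_def map_option_case split: option.splits)
qed simp

lemma trace_eq_track: "trace_eq W W' \<Longrightarrow> track L x W' = track L x W"
  unfolding track_def by (rule trace_eq_foldl[symmetric]) (auto intro: consume_commute)

text \<open>A logged event that is not taken from the word is unrelated to everything left in it, so
  skipping its resampling does not touch the variables of the remaining events. Hence a remaining
  event true in the run is also true in the tracked configuration.\<close>

lemma track_agrees:
  "track L x W = Some (L', z) \<Longrightarrow> C \<in> set L' \<Longrightarrow> i \<in> var C \<Longrightarrow> z i = exec x W i"
proof (induction W arbitrary: L' z C rule: rev_induct)
  case (snoc p W)
  obtain B y where p: "p = (B, y)" by fastforce
  obtain L1 z1 where 1: "track L x W = Some (L1, z1)"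
    using snoc.prems(1) by (cases "track L x W") auto
  then have 2: "take_source B L1 = Some L'" "z = (if B \<in> set L1 then resample B y z1 else z1)"
    using snoc.prems(1) by (auto simp: p)
  then have "z1 i = exec x W i"
    using snoc.IH[OF 1 _ snoc.prems(3)] take_source_subset[OF 2(1)] snoc.prems(2) by blast
  moreover have "\<not> related B C" if "B \<notin> set L1"
    using take_source_notin[OF 2(1) that] take_source_notin_related[OF 2(1) that] snoc.prems(2) by auto
  ultimately show ?case
    using snoc.prems(3) by (auto simp: 2(2) p resample_def related_def)
qed simp

lemma track_subset:
  assumes "x \<in> Sp" "\<And>B y x. x \<in> Sp \<Longrightarrow> y \<in> Sp \<Longrightarrow> resample B y x \<in> Sp" "snd ` set W \<subseteq> Sp"
    and "track L x W = Some (L', z)"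
  shows "set L' \<subseteq> set L" "z \<in> Sp"
proof -
  have "set L' \<subseteq> set L \<and> z \<in> Sp"
    using assms(3,4)
  proof (induction W arbitrary: L' z rule: rev_induct)
    case Nil
    then show ?case using assms(1) by simp
  next
    case (snoc p W)
    obtain B y where p: "p = (B, y)" by fastforce
    obtain L1 z1 where 1: "track L x W = Some (L1, z1)"
      using snoc.prems(2) by (cases "track L x W") auto
    then have 2: "take_source B L1 = Some L'" "z = (if B \<in> set L1 then resample B y z1 else z1)"
      using snoc.prems(2) by (auto simp: p)
    show ?case
      using snoc.IH[OF _ 1] snoc.prems(1) take_source_subset[OF 2(1)] assms(2) by (auto simp: 2(2) p)
  qed
  then show "set L' \<subseteq> set L" "z \<in> Sp" by auto
qed

text \<open>The unread suffix \<open>L\<close> is arbitrary because the reverse induction moves the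
  last label of \<open>W\<close> into it.\<close>

lemma track_self:
  "track (map fst W @ L) x W = Some (L, exec x W)"
proof (induction W arbitrary: L rule: rev_induct)
  case (snoc p W)
  then show ?case by (cases p) (simp add: exec_def)
qed simp

lemma track_empty: "foldl consume (Some ([], z)) W = Some ([], z)"
  by (induction W) auto

text \<open>
  One representative of each trace of length at most \<open>N\<close> whose last events lie in \<open>T\<close>: if the first
  \<open>B\<close> in \<open>T\<close> is not a last event it is dropped from \<open>T\<close>; if it is, then after its removal
  the last events lie in the rest of \<open>T\<close> or are related to \<open>B\<close>. This recursion mirrors
  \<^term>\<open>Q \<Omega> (insert B X) {} = Q \<Omega> X {} - measure \<Omega> (holds B) * Q \<Omega> (X - nbhd X B) {}\<close>.
\<close>

fun canonical_words :: "'a event list \<Rightarrow> nat \<Rightarrow> 'a event list \<Rightarrow> 'a event list list" where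
  "canonical_words Cs 0 T = [[]]"
| "canonical_words Cs (Suc N) [] = [[]]"
| "canonical_words Cs (Suc N) (B # T) = canonical_words Cs (Suc N) T @
     map (\<lambda>L. L @ [B]) (canonical_words Cs N (filter (\<lambda>C. C \<in> set T \<or> related C B) Cs))"

lemma canonical_words_labels: "L \<in> set (canonical_words Cs N T) \<Longrightarrow> set T \<subseteq> set Cs \<Longrightarrow> set L \<subseteq> set Cs"
  by (induction Cs N T arbitrary: L rule: canonical_words.induct) fastforce+

text \<open>Follows the recursion. If \<open>B\<close> can be moved to the end of \<open>W\<close>,
  it is split off; a last event of the rest that is unrelated to \<open>B\<close> differs from
  \<open>B\<close>, commutes past it and so was a last event of \<open>W\<close>. Otherwise
  \<open>B\<close> may be dropped from \<open>T\<close>.\<close>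

lemma canonical_words_complete:
  assumes "\<And>B. B \<in> set Cs \<Longrightarrow> related B B"
    and "fst ` set W \<subseteq> set Cs" "set T \<subseteq> set Cs" "length W \<le> N"
    and "\<And>V p. trace_eq W (V @ [p]) \<Longrightarrow> fst p \<in> set T"
  shows "\<exists>W'. trace_eq W W' \<and> map fst W' \<in> set (canonical_words Cs N T)"
  using assms
proof (induction Cs N T arbitrary: W rule: canonical_words.induct)
  case (1 Cs T)
  then show ?case by (auto intro: trace_eq.refl)
next
  case (2 Cs N)
  \<comment> \<open>A nonempty \<open>W\<close> would have a last entry, whose event would have to
    lie in the empty list.\<close>
  have "W = []"
    using "2.prems"(5)[of "butlast W" "last W"] by (cases "W = []") (auto simp: trace_eq.refl)
  then show ?case by (auto intro: trace_eq.refl)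
next
  case (3 Cs N B T)
  let ?T = "filter (\<lambda>C. C \<in> set T \<or> related C B) Cs"
  show ?case
  proof (cases "\<exists>V y. trace_eq W (V @ [(B, y)])")
    case True
    then obtain V y where V: "trace_eq W (V @ [(B, y)])" by blast
    have "\<exists>W'. trace_eq V W' \<and> map fst W' \<in> set (canonical_words Cs N ?T)"
    proof (rule "3.IH"(2))
      show "fst ` set V \<subseteq> set Cs" using trace_eq_set[OF V] "3.prems"(2) by auto
      show "length V \<le> N" using trace_eq_length[OF V] "3.prems"(4) by simp
      fix U q assume U: "trace_eq V (U @ [q])"
      have W: "trace_eq W (U @ q # (B, y) # [])"
        using trace_eq_trans[OF trace_eq_append[OF U, of "[(B, y)]"] V] by simp
      have "fst q \<in> set Cs"
        using trace_eq_set[OF W] "3.prems"(2) by auto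
      moreover have "fst q \<in> set T" if "\<not> related (fst q) B"
      proof -
        have "fst q \<noteq> B" using that "3.prems"(1,3) by auto
        then have "trace_eq W ((U @ [(B, y)]) @ [q])"
          using trace_eq.swap[OF W] that by simp
        then show ?thesis using "3.prems"(5) \<open>fst q \<noteq> B\<close> by fastforce
      qed
      ultimately show "fst q \<in> set ?T" by auto
    qed (use "3.prems" in auto)
    then obtain W' where W': "trace_eq V W'" "map fst W' \<in> set (canonical_words Cs N ?T)" by blast
    have "trace_eq W (W' @ [(B, y)])"
      using trace_eq_trans[OF trace_eq_append[OF W'(1)] V] .
    then show ?thesis using W'(2) by (intro exI[of _ "W' @ [(B, y)]"]) auto
  next
    case False
    have "\<exists>W'. trace_eq W W' \<and> map fst W' \<in> set (canonical_words Cs (Suc N) T)"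
    proof (rule "3.IH"(1))
      fix V p assume V: "trace_eq W (V @ [p])"
      then have "fst p \<noteq> B" using False by (cases p) auto
      then show "fst p \<in> set T" using "3.prems"(5)[OF V] by auto
    qed (use "3.prems" in auto)
    then show ?thesis by auto
  qed
qed

section \<open>Minimal prefixes of a run\<close>

lemma exec_in:
  assumes "x \<in> Sp" "\<And>B y x. x \<in> Sp \<Longrightarrow> y \<in> Sp \<Longrightarrow> resample B y x \<in> Sp" "snd ` set W \<subseteq> Sp"
  shows "exec x W \<in> Sp"
  using assms(3)
proof (induction W rule: rev_induct)
  case (snoc p W)
  then show ?case using assms(2) by (cases p) auto
qed (use assms(1) in simp)

text \<open>Among the trace prefixes leading into \<open>E\<close> a shortest one is taken. If its
  last entry were unrelated to a target \<open>A\<close> true at the end, \<open>A\<close> would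
  already hold before that entry, and a shorter prefix would lead into \<open>E\<close>.\<close>

lemma minimal_subrun:
  assumes "exec x W \<in> E"
    and "\<And>A z z'. \<lbrakk>A \<in> \<A>; z \<in> Sp; z' \<in> Sp; \<forall>i\<in>var A. z i = z' i; z \<in> holds A\<rbrakk> \<Longrightarrow> z' \<in> E"
    and Sp: "x \<in> Sp" "\<And>B y x. x \<in> Sp \<Longrightarrow> y \<in> Sp \<Longrightarrow> resample B y x \<in> Sp" "snd ` set W \<subseteq> Sp"
  obtains U V where "trace_eq W (U @ V)" "exec x U \<in> E"
    "\<And>A U' p. \<lbrakk>A \<in> \<A>; exec x U \<in> holds A; trace_eq U (U' @ [p])\<rbrakk> \<Longrightarrow> related (fst p) A"
proof -
  define P where "P = (\<lambda>U. exec x U \<in> E \<and> (\<exists>V. trace_eq W (U @ V)))"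
  have "P W" using assms(1) trace_eq.refl[of W] unfolding P_def by (metis append_Nil2)
  then obtain U where U: "P U" and least: "\<And>U'. P U' \<Longrightarrow> length U \<le> length U'"
    by (metis ex_has_least_nat)
  then obtain V where V: "trace_eq W (U @ V)" unfolding P_def by blast
  have "related (fst p) A"
    if A: "A \<in> \<A>" "exec x U \<in> holds A" and U': "trace_eq U (U' @ [p])" for A U' p
  proof (rule ccontr)
    assume unrel: "\<not> related (fst p) A"
    obtain B y where p: "p = (B, y)" by fastforce
    have W: "trace_eq W (U' @ p # V)" using trace_eq_trans[OF trace_eq_append[OF U'] V] by simp
    have "exec x U \<in> Sp" "exec x U' \<in> Sp"
      using trace_eq_set[OF V] trace_eq_set[OF W] Sp(3) by (intro exec_in[OF Sp(1,2)]; auto)+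
    moreover have "exec x U = resample B y (exec x U')"
      using trace_eq_exec[OF U', of x] by (simp add: p)
    then have "\<forall>i\<in>var A. exec x U i = exec x U' i"
      using unrel by (auto simp: p related_def resample_def)
    ultimately have "exec x U' \<in> E" using assms(2) A by blast
    then have "P U'" using W unfolding P_def by blast
    then show False using least[of U'] trace_eq_length[OF U'] by simp
  qed
  then show ?thesis using that V U unfolding P_def by blast
qed

text \<open>The configuration \<open>z\<close> is fixed before the target \<open>A\<close>; only the
  word \<open>L\<close> depends on \<open>A\<close>. This allows a target to be picked later
  according to the position of \<open>z\<close>.\<close>

lemma subrun_canonical_word:
  assumes "\<And>B. B \<in> set Cs \<Longrightarrow> related B B"
    and "fst ` set W \<subseteq> set Cs" "length W \<le> N"
    and "exec x W \<in> E"
    and "\<And>A z z'. \<lbrakk>A \<in> \<A>; z \<in> Sp; z' \<in> Sp; \<forall>i\<in>var A. z i = z' i; z \<in> holds A\<rbrakk> \<Longrightarrow> z' \<in> E"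
    and Sp: "x \<in> Sp" "\<And>B y x. x \<in> Sp \<Longrightarrow> y \<in> Sp \<Longrightarrow> resample B y x \<in> Sp" "snd ` set W \<subseteq> Sp"
  obtains z where "z \<in> E" 
    "\<And>A. \<lbrakk>A \<in> \<A>; z \<in> holds A\<rbrakk> \<Longrightarrow>
      \<exists>L\<in>set (canonical_words Cs N (filter (\<lambda>B. related B A) Cs)). track L x W = Some ([], z)"
proof (rule minimal_subrun[of x W E \<A> Sp, OF assms(4) _ Sp])
  fix U V
  assume V: "trace_eq W (U @ V)" "exec x U \<in> E"
    and sinks: "\<And>A U' p. \<lbrakk>A \<in> \<A>; exec x U \<in> holds A; trace_eq U (U' @ [p])\<rbrakk> \<Longrightarrow> related (fst p) A"
  have "\<exists>L\<in>set (canonical_words Cs N (filter (\<lambda>B. related B A) Cs)). track L x W = Some ([], exec x U)"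
    if A: "A \<in> \<A>" "exec x U \<in> holds A" for A
  proof -
    have U_sub: "fst ` set U \<subseteq> set Cs" "length U \<le> N"
      using trace_eq_set[OF V(1)] trace_eq_length[OF V(1)] assms(2,3) by (auto simp: image_Un)
    have "\<exists>U'. trace_eq U U' \<and> map fst U' \<in> set (canonical_words Cs N (filter (\<lambda>B. related B A) Cs))"
    proof (rule canonical_words_complete[OF assms(1) U_sub(1) _ U_sub(2)])
      fix U' p assume U': "trace_eq U (U' @ [p])"
      have "fst p \<in> set Cs"
        using trace_eq_set[OF U'] U_sub(1) by auto
      then show "fst p \<in> set (filter (\<lambda>B. related B A) Cs)" using sinks[OF A U'] by simp
    qed auto
    then obtain U' where U': "trace_eq U U'" 
      "map fst U' \<in> set (canonical_words Cs N (filter (\<lambda>B. related B A) Cs))" by blast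
    \<comment> \<open>Reading \<open>U'\<close> uses up its own labels; the word is then empty and
      \<open>V\<close> changes nothing.\<close>
    have "track (map fst U') x W = track (map fst U') x (U' @ V)"
      using trace_eq_track[OF trace_eq_trans[OF trace_eq_append[OF U'(1)] V(1)]] by metis
    also have "\<dots> = foldl consume (track (map fst U' @ []) x U') V"
      by (simp add: track_def)
    also have "\<dots> = Some ([], exec x U)"
      unfolding track_self by (simp add: track_empty trace_eq_exec[OF U'(1)])
    finally show ?thesis using U'(2) by blast
  qed
  then show thesis using that V(2) by blast
qed (use assms(5) in blast)

text \<open>The weights of the words and the numerators of the ratio obey the same recurrence. At
  length 0 the single word has weight 1, which antimonotonicity covers; the bound does not depend on
  \<open>N\<close>.\<close>

lemma sum_canonical_words_le:
  assumes "finite \<B>" "shearer \<Omega> \<B>" "set Cs \<subseteq> \<B>" "\<And>B. B \<in> set Cs \<Longrightarrow> related B B"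
    "distinct Cs" "distinct T" "set T \<subseteq> set Cs"
  shows "(\<Sum>L\<leftarrow>canonical_words Cs N T. \<Prod>B\<leftarrow>L. measure \<Omega> (holds B)) \<le> Q \<Omega> (set Cs - set T) {} / Q \<Omega> (set Cs) {}"
    (is "?s N T \<le> ?q (set Cs - set T) / ?q (set Cs)")
  using assms
proof (induction Cs N T rule: canonical_words.induct)
  case (1 Cs T)
  then have "Q \<Omega> (set Cs) {} > 0" "Q \<Omega> (set Cs) {} \<le> Q \<Omega> (set Cs - set T) {}"
    by (auto intro: shearer_Q_pos shearer_Q_antimono)
  then show ?case by simp
next
  case (2 Cs N)
  then have "Q \<Omega> (set Cs) {} > 0" by (auto intro: shearer_Q_pos)
  then show ?case by simp
next
  case (3 Cs N B T)
  let ?T = "filter (\<lambda>C. C \<in> set T \<or> related C B) Cs"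
  let ?X = "set Cs - set (B # T)"
  let ?s = "\<lambda>Ls. \<Sum>L\<leftarrow>Ls. \<Prod>B\<leftarrow>L. measure \<Omega> (holds B)"
  have pos: "Q \<Omega> (set Cs) {} > 0" using "3.prems" by (auto intro: shearer_Q_pos)
  \<comment> \<open>\<open>B\<close> belongs to \<open>?T\<close> because it is related to
    itself.\<close>
  have X: "set Cs - set T = insert B ?X" "set Cs - set ?T = ?X - nbhd ?X B"
    using "3.prems" by (auto simp: nbhd_def)
  have IH: "?s (canonical_words Cs (Suc N) T) \<le> Q \<Omega> (set Cs - set T) {} / Q \<Omega> (set Cs) {}"
    "?s (canonical_words Cs N ?T) \<le> Q \<Omega> (set Cs - set ?T) {} / Q \<Omega> (set Cs) {}"
    using "3.prems" by (intro "3.IH"; auto)+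
  have "?s (canonical_words Cs (Suc N) (B # T)) =
      ?s (canonical_words Cs (Suc N) T) + measure \<Omega> (holds B) * ?s (canonical_words Cs N ?T)"
    by (simp add: o_def sum_list_const_mult mult.commute)
  also have "\<dots> \<le> Q \<Omega> (set Cs - set T) {} / Q \<Omega> (set Cs) {} +
      measure \<Omega> (holds B) * (Q \<Omega> (set Cs - set ?T) {} / Q \<Omega> (set Cs) {})"
    by (intro add_mono IH mult_left_mono) simp
  also have "\<dots> = Q \<Omega> ?X {} / Q \<Omega> (set Cs) {}"
    unfolding X using Q_empty_insert[of ?X B \<Omega>] by (simp flip: add_divide_distrib)
  finally show ?case .
qed

subsection \<open>Resampling in the product space\<close>

locale variable_space =
  fixes n :: nat and M :: "nat \<Rightarrow> 'a measure"
  assumes prob_spaces: "\<And>i. prob_space (M i)"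
begin

abbreviation "\<Omega> \<equiv> prod_space n M"

sublocale product_prob_space M
  by (rule product_prob_spaceI) (rule prob_spaces)

sublocale prob_space \<Omega>
  unfolding prod_space_def by (rule prob_space_PiM) (rule prob_spaces)

lemma resample_in_space: "x \<in> space \<Omega> \<Longrightarrow> y \<in> space \<Omega> \<Longrightarrow> resample B y x \<in> space \<Omega>"
  by (auto simp: prod_space_def space_PiM PiE_iff extensional_def resample_def)

lemma measurable_resample [measurable]:
  assumes [measurable]: "f \<in> N \<rightarrow>\<^sub>M \<Omega>" "g \<in> N \<rightarrow>\<^sub>M \<Omega>"
  shows "(\<lambda>p. resample B (f p) (g p)) \<in> N \<rightarrow>\<^sub>M \<Omega>"
proof -
  have comp: "(\<lambda>p. h p i) \<in> N \<rightarrow>\<^sub>M M i" if "h \<in> N \<rightarrow>\<^sub>M \<Omega>" "i \<in> {1..n}" for h i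
    using measurable_compose[OF that(1)[unfolded prod_space_def] measurable_component_singleton[OF that(2)]] .
  show ?thesis
    unfolding prod_space_def
  proof (rule measurable_PiM_single)
    show "(\<lambda>p. resample B (f p) (g p)) \<in> space N \<rightarrow> (\<Pi>\<^sub>E i\<in>{1..n}. space (M i))"
      using resample_in_space measurable_space[OF assms(1)] measurable_space[OF assms(2)]
      by (auto simp: prod_space_def space_PiM)
    fix A i assume "i \<in> {1..n}" and [measurable]: "A \<in> sets (M i)"
    note [measurable] = comp[OF assms(1) \<open>i \<in> {1..n}\<close>] comp[OF assms(2) \<open>i \<in> {1..n}\<close>]
    show "{p \<in> space N. resample B (f p) (g p) i \<in> A} \<in> sets N"
      by (cases "i \<in> var B") (simp_all add: resample_def)
  qed
qed

lemma is_event_holds: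
  assumes "is_event n M B"
  shows "holds B \<in> events" "var B \<subseteq> {1..n}"
    "\<And>x y. \<lbrakk>x \<in> space \<Omega>; y \<in> space \<Omega>; \<forall>i\<in>var B. x i = y i\<rbrakk> \<Longrightarrow> x \<in> holds B \<longleftrightarrow> y \<in> holds B"
  using assms unfolding is_event_def by blast+

lemma holds_resample:
  assumes "is_event n M B" "\<not> related B C" "y \<in> space \<Omega>" "z \<in> space \<Omega>"
  shows "resample C y z \<in> holds B \<longleftrightarrow> z \<in> holds B"
  using assms by (intro is_event_holds(3)) (auto simp: related_def resample_def intro: resample_in_space[unfolded resample_def])

text \<open>Fubini over the coordinates in \<open>var B\<close> and the others: truth of
  \<open>B\<close> depends only on the former, the average over the resampled values only on the
  latter. So a configuration on which \<open>B\<close> was found true has law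
  \<open>\<Omega>\<close> again after resampling.\<close>

lemma nn_integral_resample:
  assumes B: "is_event n M B" and f [measurable]: "f \<in> borel_measurable \<Omega>"
  shows "(\<integral>\<^sup>+x. indicator (holds B) x * (\<integral>\<^sup>+y. f (resample B y x) \<partial>\<Omega>) \<partial>\<Omega>) =
    emeasure \<Omega> (holds B) * (\<integral>\<^sup>+x. f x \<partial>\<Omega>)"
proof -
  note [measurable] = is_event_holds(1)[OF B]
  define J where "J = var B"
  define K where "K = {1..n} - J"
  have KJ: "K \<inter> J = {}" "finite K" "finite J" "K \<union> J = {1..n}"
    using is_event_holds(2)[OF B] finite_subset[of J "{1..n}"] by (auto simp: J_def K_def)
  interpret J: prob_space "PiM J M" by (rule prob_space_PiM) (rule prob_spaces)
  interpret K: prob_space "PiM K M" by (rule prob_space_PiM) (rule prob_spaces)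
  have fold: "(\<integral>\<^sup>+x. g x \<partial>\<Omega>) = (\<integral>\<^sup>+u. \<integral>\<^sup>+v. g (merge K J (u, v)) \<partial>PiM J M \<partial>PiM K M)"
    if "g \<in> borel_measurable \<Omega>" for g
    using product_nn_integral_fold[OF KJ(1-3), of g] that by (simp add: KJ(4) prod_space_def)
  have merge [measurable]: "merge K J \<in> PiM K M \<Otimes>\<^sub>M PiM J M \<rightarrow>\<^sub>M \<Omega>"
    using measurable_merge[of K J M] by (simp add: KJ(4) prod_space_def)
  have in_space: "merge K J (u, v) \<in> space \<Omega>" if "u \<in> space (PiM K M)" "v \<in> space (PiM J M)" for u v
    using measurable_space[OF merge, of "(u, v)"] that by (simp add: space_pair_measure)
  have resample_merge: "resample B (merge K J (u', v')) (merge K J (u, v)) = merge K J (u, v')" for u v u' v'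
    using KJ(1) by (auto simp: resample_def merge_def J_def fun_eq_iff)
  define p where "p u = (\<integral>\<^sup>+v. indicator (holds B) (merge K J (u, v)) \<partial>PiM J M :: ennreal)" for u
  have p_eq: "p u = p u'" if "u \<in> space (PiM K M)" "u' \<in> space (PiM K M)" for u u'
    unfolding p_def
  proof (rule nn_integral_cong)
    fix v assume "v \<in> space (PiM J M)"
    then have "merge K J (u, v) \<in> holds B \<longleftrightarrow> merge K J (u', v) \<in> holds B"
      using in_space that KJ(1) by (intro is_event_holds(3)[OF B]) (auto simp: merge_def J_def)
    then show "indicator (holds B) (merge K J (u, v)) = (indicator (holds B) (merge K J (u', v)) :: ennreal)"
      by (simp add: indicator_def)
  qed
  have p: "p u = emeasure \<Omega> (holds B)" if "u \<in> space (PiM K M)" for u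
  proof -
    have "emeasure \<Omega> (holds B) = (\<integral>\<^sup>+u'. p u' \<partial>PiM K M)"
      using fold[of "indicator (holds B)"] by (simp add: p_def)
    also have "\<dots> = (\<integral>\<^sup>+u'. p u \<partial>PiM K M)"
      by (rule nn_integral_cong) (rule p_eq[OF _ that])
    finally show ?thesis by (simp add: K.emeasure_space_1)
  qed
  define h where "h u = (\<integral>\<^sup>+v. f (merge K J (u, v)) \<partial>PiM J M)" for u
  have h: "(\<integral>\<^sup>+y. f (resample B y (merge K J (u, v))) \<partial>\<Omega>) = h u"
    if "u \<in> space (PiM K M)" "v \<in> space (PiM J M)" for u v
  proof -
    note [measurable] = in_space[OF that]
    show ?thesis
      by (subst fold) (simp_all add: resample_merge h_def K.emeasure_space_1)
  qed
  have "(\<integral>\<^sup>+x. indicator (holds B) x * (\<integral>\<^sup>+y. f (resample B y x) \<partial>\<Omega>) \<partial>\<Omega>) =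
      (\<integral>\<^sup>+u. \<integral>\<^sup>+v. indicator (holds B) (merge K J (u, v)) * h u \<partial>PiM J M \<partial>PiM K M)"
    by (subst fold) (auto simp: h intro!: nn_integral_cong)
  also have "\<dots> = (\<integral>\<^sup>+u. p u * h u \<partial>PiM K M)"
    unfolding p_def by (intro nn_integral_cong nn_integral_multc) measurable
  also have "\<dots> = (\<integral>\<^sup>+u. emeasure \<Omega> (holds B) * h u \<partial>PiM K M)"
    by (intro nn_integral_cong) (simp add: p)
  also have "\<dots> = emeasure \<Omega> (holds B) * (\<integral>\<^sup>+x. f x \<partial>\<Omega>)"
    unfolding fold[OF f] h_def by (intro nn_integral_cmult) measurable
  finally show ?thesis .
qed

text \<open>
  The probability, from the configuration \<open>z\<close>, that resampling the events of \<open>L\<close> in this order finds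
  each of them true and ends in \<open>F\<close>.
\<close>

primrec prefix_prob :: "'a config set \<Rightarrow> 'a event list \<Rightarrow> 'a config \<Rightarrow> ennreal" where
  "prefix_prob F [] z = indicator F z"
| "prefix_prob F (B # L) z = indicator (holds B) z * (\<integral>\<^sup>+y. prefix_prob F L (resample B y z) \<partial>\<Omega>)"

lemma measurable_prefix_prob:
  assumes "F \<in> events" "\<forall>B\<in>set L. is_event n M B"
  shows "prefix_prob F L \<in> borel_measurable \<Omega>"
  using assms(2)
proof (induction L)
  case Nil
  show ?case using assms(1) by simp
next
  case (Cons B L)
  then have [measurable]: "prefix_prob F L \<in> borel_measurable \<Omega>" "holds B \<in> events"
    by (auto simp: is_event_holds)
  show ?case by simp
qed

text \<open>By \<open>nn_integral_resample\<close> every event of the word contributes its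
  probability and leaves the law \<open>\<Omega>\<close> for the rest.\<close>

lemma nn_integral_prefix_prob:
  assumes "F \<in> events" "\<forall>B\<in>set L. is_event n M B"
  shows "(\<integral>\<^sup>+z. prefix_prob F L z \<partial>\<Omega>) = ennreal ((\<Prod>B\<leftarrow>L. prob (holds B)) * prob F)"
  using assms(2)
proof (induction L)
  case Nil
  then show ?case using assms(1) by (simp add: emeasure_eq_measure)
next
  case (Cons B L)
  then have "prefix_prob F L \<in> borel_measurable \<Omega>" using measurable_prefix_prob[OF assms(1)] by simp
  with Cons show ?case
    using prod_list_nonneg[of "map (\<lambda>B. prob (holds B)) L"]
    by (simp add: nn_integral_resample emeasure_eq_measure ennreal_mult' mult.assoc)
qed

text \<open>\<open>B\<close> is moved past each earlier event \<open>C\<close>: being unrelated,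
  neither resampling affects the truth of the other event, the resamplings commute, and Fubini
  exchanges their samples.\<close>

lemma prefix_prob_take_source:
  assumes "F \<in> events" "\<forall>B\<in>set L. is_event n M B" "is_event n M B"
    and "take_source B L = Some L'" "B \<in> set L" "z \<in> space \<Omega>"
  shows "prefix_prob F L z = indicator (holds B) z * (\<integral>\<^sup>+y. prefix_prob F L' (resample B y z) \<partial>\<Omega>)"
  using assms(2,4-)
proof (induction L arbitrary: L' z)
  case (Cons C L)
  show ?case
  proof (cases "B = C")
    case True
    then show ?thesis using Cons.prems by simp
  next
    case False
    then obtain L0 where L0: "take_source B L = Some L0" "L' = C # L0" and unrel: "\<not> related B C"
      using Cons.prems by (auto split: if_splits)
    interpret pair_sigma_finite \<Omega> \<Omega> ..
    have C: "is_event n M C" using Cons.prems by auto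
    have "\<forall>B\<in>set L0. is_event n M B" using take_source_subset[OF L0(1)] Cons.prems by auto
    then have [measurable]: "prefix_prob F L0 \<in> borel_measurable \<Omega>" "holds B \<in> events" "holds C \<in> events"
      using measurable_prefix_prob[OF assms(1)] C assms(3) by (auto simp: is_event_holds)
    note z [measurable] = Cons.prems(4)
    have indB: "indicator (holds B) (resample C y z) = (indicator (holds B) z :: ennreal)"
      and indC: "indicator (holds C) (resample B y z) = (indicator (holds C) z :: ennreal)"
      if "y \<in> space \<Omega>" for y
      using holds_resample[OF assms(3) unrel that z] holds_resample[OF C _ that z, of B] unrel
      by (auto simp: indicator_def related_commute)
    have "prefix_prob F (C # L) z =
        indicator (holds C) z * (\<integral>\<^sup>+y. indicator (holds B) (resample C y z) *
          (\<integral>\<^sup>+y'. prefix_prob F L0 (resample B y' (resample C y z)) \<partial>\<Omega>) \<partial>\<Omega>)"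
      using Cons.prems L0(1) False z resample_in_space
      by (auto intro!: arg_cong2[of _ _ _ _ "(*)"] nn_integral_cong Cons.IH)
    also have "\<dots> = indicator (holds C) z * (\<integral>\<^sup>+y. indicator (holds B) z *
          (\<integral>\<^sup>+y'. prefix_prob F L0 (resample C y (resample B y' z)) \<partial>\<Omega>) \<partial>\<Omega>)"
      by (intro arg_cong2[of _ _ _ _ "(*)"] nn_integral_cong refl) 
        (simp_all add: indB resample_commute[OF unrel])
    also have "\<dots> = indicator (holds C) z * (indicator (holds B) z *
          (\<integral>\<^sup>+y. \<integral>\<^sup>+y'. prefix_prob F L0 (resample C y (resample B y' z)) \<partial>\<Omega> \<partial>\<Omega>))"
      by (subst nn_integral_cmult) measurable
    also have "(\<integral>\<^sup>+y. \<integral>\<^sup>+y'. prefix_prob F L0 (resample C y (resample B y' z)) \<partial>\<Omega> \<partial>\<Omega>) =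
        (\<integral>\<^sup>+y'. \<integral>\<^sup>+y. prefix_prob F L0 (resample C y (resample B y' z)) \<partial>\<Omega> \<partial>\<Omega>)"
      by (rule Fubini') measurable
    also have "indicator (holds C) z * (indicator (holds B) z * \<dots>) =
        indicator (holds B) z * (\<integral>\<^sup>+y'. indicator (holds C) z *
          (\<integral>\<^sup>+y. prefix_prob F L0 (resample C y (resample B y' z)) \<partial>\<Omega>) \<partial>\<Omega>)"
      by (subst nn_integral_cmult) (measurable, simp add: ac_simps)
    also have "\<dots> = indicator (holds B) z * (\<integral>\<^sup>+y'. prefix_prob F L' (resample B y' z) \<partial>\<Omega>)"
      by (intro arg_cong2[of _ _ _ _ "(*)"] nn_integral_cong refl) (simp_all add: L0 indC)
    finally show ?thesis .
  qed
qed simp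

end

subsection \<open>Runs of the algorithm\<close>

locale mt_run = variable_space n M + S: prob_space S
  for n :: nat and M :: "nat \<Rightarrow> 'a measure" and S :: "'s measure" +
  fixes \<B> :: "'a event set" and sel :: "('s, 'a) rule"
  assumes finite_bad: "finite \<B>"
    and bad_event: "\<And>B. B \<in> \<B> \<Longrightarrow> is_event n M B"
    and selection: "selection_rule \<Omega> \<B> S sel"
begin

abbreviation "P \<equiv> mt_space \<Omega> S"

sublocale seq: product_prob_space "\<lambda>_::nat. \<Omega>"
  by (rule product_prob_spaceI) unfold_locales

sublocale seq: prob_space "PiM (UNIV :: nat set) (\<lambda>_. \<Omega>)"
  by (rule prob_space_PiM) unfold_locales

sublocale run: prob_space P
  unfolding mt_space_def by (intro prob_space_pair) unfold_locales

definition "hist t p = mt_history \<B> sel (fst p) (snd p) t"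

definition "state t p = hist t p t"

definition "chosen t p =
  (if \<exists>B\<in>\<B>. state t p \<in> holds B then Some (sel (snd p) t (hist t p)) else None)"

text \<open>Idle steps after termination add no entry.\<close>

primrec run_log where
  "run_log 0 p = []"
| "run_log (Suc t) p = run_log t p @ (case chosen t p of None \<Rightarrow> [] | Some B \<Rightarrow> [(B, fst p (Suc t))])"

lemma mt_state_eq: "mt_state \<B> sel (fst p) (snd p) t = state t p"
  by (simp add: mt_state_def hist_def state_def)

lemma hist_Suc:
  "hist (Suc t) p = (hist t p)(Suc t := case chosen t p of None \<Rightarrow> state t p
     | Some B \<Rightarrow> resample B (fst p (Suc t)) (state t p))"
  by (simp add: hist_def chosen_def Let_def state_def)

lemma state_Suc:
  "state (Suc t) p = (case chosen t p of None \<Rightarrow> state t p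
     | Some B \<Rightarrow> resample B (fst p (Suc t)) (state t p))"
  by (simp add: state_def hist_Suc)

lemma exec_run_log: "exec (fst p 0) (run_log t p) = state t p"
proof (induction t)
  case 0
  show ?case by (simp add: state_def hist_def)
next
  case (Suc t)
  then show ?case by (simp only: state_Suc run_log.simps) (simp split: option.split)
qed

text \<open>Adaptedness: samples later than \<open>t\<close> do not influence the run up to time
  \<open>t\<close>.\<close>

lemma hist_cong:
  assumes "\<And>k. k \<le> t \<Longrightarrow> fst q k = fst p k" "snd q = snd p"
  shows "hist t q = hist t p"
  using assms(1)
proof (induction t)
  case 0
  then show ?case by (auto simp: hist_def)
next
  case (Suc t)
  have h: "hist t q = hist t p" by (rule Suc.IH) (simp add: Suc.prems)
  then have "state t q = state t p" "chosen t q = chosen t p"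
    by (simp_all add: state_def chosen_def assms(2))
  with h show ?case by (intro ext) (auto simp: hist_Suc Suc.prems split: option.split)
qed

lemma hist_upd: "t < k \<Longrightarrow> hist t ((fst p)(k := y), snd p) = hist t p"
  by (rule hist_cong) auto

lemma chosen_upd:
  assumes "t < k"
  shows "chosen t ((fst p)(k := y), snd p) = chosen t p"
  unfolding chosen_def state_def hist_upd[OF assms] by simp

lemma run_log_upd: "t < k \<Longrightarrow> run_log t ((fst p)(k := y), snd p) = run_log t p"
  by (induction t) (auto simp: chosen_upd split: option.split)

lemma length_run_log: "length (run_log t p) \<le> t"
  by (induction t) (auto split: option.split)

section \<open>Measurability of the run\<close>

lemma measurable_sample [measurable]: "(\<lambda>p. fst p t) \<in> P \<rightarrow>\<^sub>M \<Omega>"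
  unfolding mt_space_def by measurable

lemma measurable_seed [measurable]: "snd \<in> P \<rightarrow>\<^sub>M S"
  unfolding mt_space_def by measurable

lemma sample_in_space: "p \<in> space P \<Longrightarrow> fst p t \<in> space \<Omega>"
  using measurable_space[OF measurable_sample] .

text \<open>Measurability of \<open>hist t\<close> is a hypothesis because its inductive proof uses
  this lemma at each step.\<close>

lemma measurable_chosen_aux:
  assumes [measurable]: "hist t \<in> P \<rightarrow>\<^sub>M PiM {..t} (\<lambda>_. \<Omega>)"
  shows "chosen t \<in> P \<rightarrow>\<^sub>M count_space (insert None (Some ` \<B>))"
    "(\<lambda>p. state t p) \<in> P \<rightarrow>\<^sub>M \<Omega>"
proof -
  show st [measurable]: "(\<lambda>p. state t p) \<in> P \<rightarrow>\<^sub>M \<Omega>"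
    unfolding state_def using measurable_compose[OF assms measurable_component_singleton[of t]] by simp
  have sp: "snd p \<in> space S" "hist t p \<in> space (PiM {..t} (\<lambda>_. \<Omega>))" if "p \<in> space P" for p
    using that measurable_space[OF assms] measurable_space[OF measurable_seed] by auto
  have sel: "sel (snd p) t (hist t p) \<in> \<B>" if "p \<in> space P" "\<exists>B\<in>\<B>. state t p \<in> holds B" for p
    using selection sp[OF that(1)] that(2) unfolding selection_rule_def state_def by blast
  have act: "{p \<in> space P. \<exists>B\<in>\<B>. state t p \<in> holds B} \<in> sets P"
    using finite_bad is_event_holds(1)[OF bad_event] by measurable
  have "chosen t -` {a} \<inter> space P \<in> sets P" if "a \<in> insert None (Some ` \<B>)" for a
  proof (cases a)
    case None
    have "chosen t -` {a} \<inter> space P = space P - {p \<in> space P. \<exists>B\<in>\<B>. state t p \<in> holds B}"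
      by (auto simp: None chosen_def split: if_splits)
    then show ?thesis using act by auto
  next
    case (Some B)
    then have "B \<in> \<B>" using that by auto
    let ?R = "{q \<in> space (S \<Otimes>\<^sub>M PiM {..t} (\<lambda>_. \<Omega>)). sel (fst q) t (snd q) = B}"
    have [measurable]: "?R \<in> sets (S \<Otimes>\<^sub>M PiM {..t} (\<lambda>_. \<Omega>))"
      using selection \<open>B \<in> \<B>\<close> by (simp add: selection_rule_def)
    have "chosen t -` {a} \<inter> space P = {p \<in> space P. \<exists>B\<in>\<B>. state t p \<in> holds B} \<inter>
        ((\<lambda>p. (snd p, hist t p)) -` ?R \<inter> space P)"
      using sp by (auto simp: Some chosen_def space_pair_measure split: if_splits)
    also have "\<dots> \<in> sets P"
      by (intro sets.Int act measurable_sets[where A = "S \<Otimes>\<^sub>M PiM {..t} (\<lambda>_. \<Omega>)"]) measurable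
    finally show ?thesis .
  qed
  then show "chosen t \<in> P \<rightarrow>\<^sub>M count_space (insert None (Some ` \<B>))"
    using finite_bad sel by (subst measurable_count_space_eq2) (auto simp: chosen_def)
qed

lemma measurable_hist: "hist t \<in> P \<rightarrow>\<^sub>M PiM {..t} (\<lambda>_. \<Omega>)"
proof (induction t)
  case 0
  show ?case unfolding hist_def mt_history.simps by (rule measurable_restrict) simp
next
  case (Suc t)
  note [measurable] = Suc measurable_chosen_aux[OF Suc]
  have "(\<lambda>p. case chosen t p of None \<Rightarrow> state t p
     | Some B \<Rightarrow> resample B (fst p (Suc t)) (state t p)) \<in> P \<rightarrow>\<^sub>M \<Omega>"
  proof (rule measurable_compose_countable'[where g = "chosen t" and I = "insert None (Some ` \<B>)"])
    fix a
    show "(\<lambda>p. case a of None \<Rightarrow> state t p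
     | Some B \<Rightarrow> resample B (fst p (Suc t)) (state t p)) \<in> P \<rightarrow>\<^sub>M \<Omega>"
      by (cases a) simp_all
  qed (use finite_bad measurable_chosen_aux[OF Suc] in \<open>auto intro: countable_finite\<close>)
  then show ?case
    unfolding hist_Suc by (intro measurable_fun_upd[of _ "{..t}"] Suc) auto
qed

lemmas measurable_chosen = measurable_chosen_aux(1)[OF measurable_hist]
  and measurable_state [measurable] = measurable_chosen_aux(2)[OF measurable_hist]

lemma chosen_Some:
  assumes "p \<in> space P" "chosen t p = Some B"
  shows "B \<in> \<B>" "state t p \<in> holds B"
proof -
  have "snd p \<in> space S" "hist t p \<in> space (PiM {..t} (\<lambda>_. \<Omega>))" "\<exists>B\<in>\<B>. state t p \<in> holds B"
    using assms measurable_space[OF measurable_hist] measurable_space[OF measurable_seed]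
    by (auto simp: chosen_def split: if_splits)
  moreover have "B = sel (snd p) t (hist t p)"
    using assms(2) by (auto simp: chosen_def split: if_splits)
  ultimately show "B \<in> \<B>" "state t p \<in> holds B"
    using selection unfolding selection_rule_def state_def by blast+
qed

lemma run_log_sets:
  assumes "p \<in> space P"
  shows "fst ` set (run_log t p) \<subseteq> \<B>" "snd ` set (run_log t p) \<subseteq> space \<Omega>"
proof -
  have "fst ` set (run_log t p) \<subseteq> \<B> \<and> snd ` set (run_log t p) \<subseteq> space \<Omega>"
    using chosen_Some[OF assms] sample_in_space[OF assms]
    by (induction t) (auto split: option.split)
  then show "fst ` set (run_log t p) \<subseteq> \<B>" "snd ` set (run_log t p) \<subseteq> space \<Omega>" by auto
qed

text \<open>Replacing sample \<open>k\<close> by an independent copy preserves the law of the run.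
  It stands in for conditioning on all the other samples and the seed.\<close>

lemma nn_integral_refresh:
  assumes f [measurable]: "f \<in> borel_measurable P"
  shows "(\<integral>\<^sup>+p. f p \<partial>P) = (\<integral>\<^sup>+p. \<integral>\<^sup>+y. f ((fst p)(k := y), snd p) \<partial>\<Omega> \<partial>P)"
proof -
  let ?I = "PiM (UNIV :: nat set) (\<lambda>_. \<Omega>)"
  interpret pair_sigma_finite \<Omega> ?I ..
  interpret SS: pair_sigma_finite \<Omega> S ..
  have f' [measurable]: "f \<in> borel_measurable (?I \<Otimes>\<^sub>M S)" using f by (simp add: mt_space_def)
  have upd [measurable]: "(\<lambda>(y, Y). Y(k := y)) \<in> \<Omega> \<Otimes>\<^sub>M ?I \<rightarrow>\<^sub>M ?I"
    unfolding case_prod_beta' by (rule measurable_fun_upd[of _ UNIV]) auto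
  have distr: "distr (\<Omega> \<Otimes>\<^sub>M ?I) ?I (\<lambda>(y, Y). Y(k := y)) = ?I"
    using distr_pair_PiM_eq_PiM[of UNIV "\<lambda>_. \<Omega>" k] prob_space_axioms by simp
  have [measurable]: "(\<lambda>q. f ((snd (fst q))(k := fst (fst q)), snd q)) \<in> borel_measurable ((\<Omega> \<Otimes>\<^sub>M ?I) \<Otimes>\<^sub>M S)"
    using measurable_compose[OF measurable_Pair[OF measurable_compose[OF measurable_fst upd] measurable_snd] f']
    by (simp add: case_prod_beta)
  have "(\<integral>\<^sup>+p. f p \<partial>P) = (\<integral>\<^sup>+Y. \<integral>\<^sup>+s. f (Y, s) \<partial>S \<partial>?I)"
    unfolding mt_space_def by (rule S.nn_integral_fst[symmetric]) (rule f')
  also have "\<dots> = (\<integral>\<^sup>+Y. \<integral>\<^sup>+s. f (Y, s) \<partial>S \<partial>distr (\<Omega> \<Otimes>\<^sub>M ?I) ?I (\<lambda>(y, Y). Y(k := y)))"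
    by (simp add: distr)
  also have "\<dots> = (\<integral>\<^sup>+q. \<integral>\<^sup>+s. f ((snd q)(k := fst q), s) \<partial>S \<partial>(\<Omega> \<Otimes>\<^sub>M ?I))"
    by (subst nn_integral_distr) (auto simp: case_prod_beta)
  also have "\<dots> = (\<integral>\<^sup>+Y. \<integral>\<^sup>+y. \<integral>\<^sup>+s. f (Y(k := y), s) \<partial>S \<partial>\<Omega> \<partial>?I)"
    by (subst nn_integral_snd[symmetric]) (auto)
  also have "\<dots> = (\<integral>\<^sup>+Y. \<integral>\<^sup>+s. \<integral>\<^sup>+y. f (Y(k := y), s) \<partial>\<Omega> \<partial>S \<partial>?I)"
  proof (rule nn_integral_cong)
    fix Y assume "Y \<in> space ?I"
    then have "(\<lambda>(y, s). f (Y(k := y), s)) \<in> borel_measurable (\<Omega> \<Otimes>\<^sub>M S)"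
      using measurable_compose[OF _ \<open>(\<lambda>q. f ((snd (fst q))(k := fst (fst q)), snd q)) \<in> _\<close>,
          of "\<lambda>q. ((fst q, Y), snd q)" "\<Omega> \<Otimes>\<^sub>M S"] by (simp add: case_prod_beta)
    then show "(\<integral>\<^sup>+y. \<integral>\<^sup>+s. f (Y(k := y), s) \<partial>S \<partial>\<Omega>) = (\<integral>\<^sup>+s. \<integral>\<^sup>+y. f (Y(k := y), s) \<partial>\<Omega> \<partial>S)"
      by (rule SS.Fubini'[symmetric])
  qed
  also have "\<dots> = (\<integral>\<^sup>+p. \<integral>\<^sup>+y. f ((fst p)(k := y), snd p) \<partial>\<Omega> \<partial>P)"
  proof -
    have "(\<lambda>(p, y). f ((fst p)(k := y), snd p)) \<in> borel_measurable ((?I \<Otimes>\<^sub>M S) \<Otimes>\<^sub>M \<Omega>)"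
      using measurable_compose[OF _ \<open>(\<lambda>q. f ((snd (fst q))(k := fst (fst q)), snd q)) \<in> _\<close>,
          of "\<lambda>q. ((snd q, fst (fst q)), snd (fst q))" "(?I \<Otimes>\<^sub>M S) \<Otimes>\<^sub>M \<Omega>"] by (simp add: case_prod_beta)
    then have "(\<lambda>p. \<integral>\<^sup>+y. f ((fst p)(k := y), snd p) \<partial>\<Omega>) \<in> borel_measurable (?I \<Otimes>\<^sub>M S)"
      by measurable
    from S.nn_integral_fst[OF this] show ?thesis by (simp add: mt_space_def)
  qed
  finally show ?thesis .
qed

section \<open>Following a fixed word along the run\<close>

abbreviation "tracked L t p \<equiv> track L (fst p 0) (run_log t p)"

lemma tracked_Suc:
  "tracked L (Suc t) p = (case chosen t p of None \<Rightarrow> tracked L t p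
     | Some B \<Rightarrow> consume (tracked L t p) (B, fst p (Suc t)))"
  by (simp split: option.split)

lemma tracked_upd:
  "track L (fst p 0) (run_log (Suc t) ((fst p)(Suc t := y), snd p)) =
    (case chosen t p of None \<Rightarrow> tracked L t p | Some B \<Rightarrow> consume (tracked L t p) (B, y))"
  by (simp add: run_log_upd chosen_upd split: option.split)

text \<open>\<open>g\<close> may depend on \<open>p\<close> as well: the induction absorbs the last
  step, which reads the sample \<open>fst p (Suc t)\<close>, into \<open>g\<close>.\<close>

lemma measurable_tracked:
  fixes g :: "'a event list \<Rightarrow> 'a config \<Rightarrow> _ \<Rightarrow> ennreal"
  assumes "\<And>L. (\<lambda>q. g L (fst q) (snd q)) \<in> borel_measurable (\<Omega> \<Otimes>\<^sub>M P)"
  shows "(\<lambda>p. case tracked L t p of None \<Rightarrow> 0 | Some (L', z) \<Rightarrow> g L' z p) \<in> borel_measurable P"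
  using assms
proof (induction t arbitrary: g)
  case 0
  have "(\<lambda>p. (fst p 0, p)) \<in> P \<rightarrow>\<^sub>M \<Omega> \<Otimes>\<^sub>M P" by measurable
  from measurable_compose[OF this 0[of L]] show ?case by simp
next
  case (Suc t)
  let ?h = "\<lambda>a p. case a of None \<Rightarrow> (case tracked L t p of None \<Rightarrow> 0 | Some (L', z) \<Rightarrow> g L' z p)
    | Some B \<Rightarrow> (case tracked L t p of None \<Rightarrow> 0 | Some (L', z) \<Rightarrow>
        (case take_source B L' of None \<Rightarrow> 0
         | Some L'' \<Rightarrow> g L'' (if B \<in> set L' then resample B (fst p (Suc t)) z else z) p))"
  have "(\<lambda>p. ?h (chosen t p) p) \<in> borel_measurable P"
  proof (rule measurable_compose_countable'[OF _ measurable_chosen])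
    show "(\<lambda>p. ?h a p) \<in> borel_measurable P" for a
    proof (cases a)
      case None
      then show ?thesis using Suc by simp
    next
      case (Some B)
      have "(\<lambda>q. case take_source B L' of None \<Rightarrow> 0 | Some L'' \<Rightarrow>
          g L'' (if B \<in> set L' then resample B (fst (snd q) (Suc t)) (fst q) else fst q) (snd q))
          \<in> borel_measurable (\<Omega> \<Otimes>\<^sub>M P)" for L'
      proof (cases "take_source B L'")
        case (Some L'')
        have "(\<lambda>q. (if B \<in> set L' then resample B (fst (snd q) (Suc t)) (fst q) else fst q, snd q))
            \<in> \<Omega> \<Otimes>\<^sub>M P \<rightarrow>\<^sub>M \<Omega> \<Otimes>\<^sub>M P"
          by (cases "B \<in> set L'") simp_all
        from measurable_compose[OF this Suc.prems[of L'']] show ?thesis by (simp add: Some)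
      qed simp
      from Suc.IH[OF this] show ?thesis by (simp add: Some)
    qed
  qed (use finite_bad in \<open>auto intro: countable_finite\<close>)
  also have "(\<lambda>p. ?h (chosen t p) p) =
      (\<lambda>p. case tracked L (Suc t) p of None \<Rightarrow> 0 | Some (L', z) \<Rightarrow> g L' z p)"
    unfolding tracked_Suc by (intro ext) (auto simp: map_option_case split: option.split)
  finally show ?case .
qed

text \<open>The chance of completing the rest of \<open>L\<close> with fresh samples and ending in
  \<open>F\<close>, counted as 0 once tracking has failed.\<close>

definition "weight F L t p = (case tracked L t p of None \<Rightarrow> 0 | Some (L', z) \<Rightarrow> prefix_prob F L' z)"

context
  fixes F L
  assumes F [measurable]: "F \<in> events" and L: "\<forall>B\<in>set L. is_event n M B"
begin

lemma tracked_sets: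
  assumes "p \<in> space P" "tracked L t p = Some (L', z)"
  shows "set L' \<subseteq> set L" "z \<in> space \<Omega>"
  using track_subset[of "fst p 0" "space \<Omega>" "run_log t p" L L' z, OF sample_in_space[OF assms(1)] resample_in_space
      run_log_sets(2)[OF assms(1)] assms(2)] by auto

text \<open>\<open>measurable_tracked\<close> asks for measurability at every list, whereas
  \<open>prefix_prob\<close> has it for lists of genuine events; the guard bridges the
  difference.\<close>

lemma weight_alt:
  "p \<in> space P \<Longrightarrow> weight F L t p = (case tracked L t p of None \<Rightarrow> 0 | Some (L', z) \<Rightarrow>
     if set L' \<subseteq> set L then prefix_prob F L' z else 0)"
  unfolding weight_def using tracked_sets by (auto split: option.split)

lemma measurable_weight [measurable]: "weight F L t \<in> borel_measurable P"
proof -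
  have "(\<lambda>q. if set L' \<subseteq> set L then prefix_prob F L' (fst q) else 0) \<in> borel_measurable (\<Omega> \<Otimes>\<^sub>M P)" for L'
  proof (cases "set L' \<subseteq> set L")
    case True
    then have [measurable]: "prefix_prob F L' \<in> borel_measurable \<Omega>"
      using L F by (intro measurable_prefix_prob) auto
    show ?thesis by simp
  qed simp
  from measurable_tracked[of "\<lambda>L' z _. if set L' \<subseteq> set L then prefix_prob F L' z else 0", OF this, of L t]
  show ?thesis
    by (subst measurable_cong[OF weight_alt]) auto
qed

text \<open>The weight is a supermartingale.\<close>

lemma weight_step:
  assumes p: "p \<in> space P"
  shows "(\<integral>\<^sup>+y. weight F L (Suc t) ((fst p)(Suc t := y), snd p) \<partial>\<Omega>) \<le> weight F L t p"
proof (cases "tracked L t p")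
  case None
  then show ?thesis
    by (cases "chosen t p") (simp_all add: weight_def tracked_upd del: run_log.simps)
next
  case (Some a)
  obtain L' z where a: "a = (L', z)" by fastforce
  note tr = Some[unfolded a]
  have wt: "weight F L t p = prefix_prob F L' z" by (simp add: weight_def tr)
  show ?thesis
  proof (cases "chosen t p")
    case None
    then show ?thesis
      by (simp add: weight_def tracked_upd emeasure_space_1 del: run_log.simps)
  next
    case (Some B)
    note B = chosen_Some[OF p Some]
    have w: "weight F L (Suc t) ((fst p)(Suc t := y), snd p) = (case take_source B L' of None \<Rightarrow> 0
        | Some L'' \<Rightarrow> prefix_prob F L'' (if B \<in> set L' then resample B y z else z))" for y
      by (auto simp: weight_def tracked_upd Some tr simp del: run_log.simps split: option.split)
    show ?thesis
    proof (cases "take_source B L'")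
      case None
      \<comment> \<open>Here tracking fails and the weight drops to 0; in all other cases equality
        holds.\<close>
      then show ?thesis by (simp add: w)
    next
      case (Some L'')
      show ?thesis
      proof (cases "B \<in> set L'")
        case False
        then show ?thesis
          using take_source_notin[OF Some False] by (simp add: w wt Some emeasure_space_1)
      next
        case True
        have st: "state t p \<in> space \<Omega>" using measurable_space[OF measurable_state p] .
        \<comment> \<open>\<open>B\<close> is true in the run, and \<open>z\<close> agrees with the
          run on \<open>var B\<close>.\<close>
        have "z \<in> holds B"
          using is_event_holds(3)[OF bad_event[OF B(1)] tracked_sets(2)[OF p tr] st] B(2)
            track_agrees[OF tr True] by (simp add: exec_run_log)
        moreover have "prefix_prob F L' z = indicator (holds B) z * (\<integral>\<^sup>+y. prefix_prob F L'' (resample B y z) \<partial>\<Omega>)"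
          using F L tracked_sets[OF p tr] bad_event[OF B(1)] Some True by (intro prefix_prob_take_source) auto
        ultimately show ?thesis
          using True by (simp add: w wt Some)
      qed
    qed
  qed
qed

text \<open>Sample 0 is refreshed too, which turns the initial weight into the integral of
  \<open>prefix_prob\<close>; each later refresh exposes one supermartingale step.\<close>

lemma nn_integral_weight:
  "(\<integral>\<^sup>+p. weight F L t p \<partial>P) \<le> ennreal ((\<Prod>B\<leftarrow>L. prob (holds B)) * prob F)"
proof (induction t)
  case 0
  have "(\<integral>\<^sup>+p. weight F L 0 p \<partial>P) =
      (\<integral>\<^sup>+p. \<integral>\<^sup>+y. weight F L 0 ((fst p)(0 := y), snd p) \<partial>\<Omega> \<partial>P)"
    by (rule nn_integral_refresh) measurable
  also have "\<dots> = (\<integral>\<^sup>+y. prefix_prob F L y \<partial>\<Omega>)"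
    by (simp add: weight_def run.emeasure_space_1)
  also have "\<dots> = ennreal ((\<Prod>B\<leftarrow>L. prob (holds B)) * prob F)"
    by (rule nn_integral_prefix_prob[OF F L])
  finally show ?case by simp
next
  case (Suc t)
  have "(\<integral>\<^sup>+p. weight F L (Suc t) p \<partial>P) =
      (\<integral>\<^sup>+p. \<integral>\<^sup>+y. weight F L (Suc t) ((fst p)(Suc t := y), snd p) \<partial>\<Omega> \<partial>P)"
    by (rule nn_integral_refresh) measurable
  also have "\<dots> \<le> (\<integral>\<^sup>+p. weight F L t p \<partial>P)"
    by (intro nn_integral_mono weight_step)
  finally show ?case using Suc by simp
qed

text \<open>The weight equals 1 once the word is used up inside \<open>F\<close>.\<close>

lemma tracked_prob:
  shows "{p \<in> space P. \<exists>z\<in>F. tracked L t p = Some ([], z)} \<in> sets P" (is "?T \<in> _")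
    and "measure P {p \<in> space P. \<exists>z\<in>F. tracked L t p = Some ([], z)} \<le> (\<Prod>B\<leftarrow>L. prob (holds B)) * prob F"
proof -
  have "(\<lambda>p. case tracked L t p of None \<Rightarrow> 0 :: ennreal | Some (L', z) \<Rightarrow> if L' = [] then indicator F z else 0)
      \<in> borel_measurable P" (is "?g \<in> _")
    by (rule measurable_tracked) simp
  moreover have "?T = {p \<in> space P. ?g p \<noteq> 0}"
    by (auto simp: indicator_def split: option.splits if_splits)
  ultimately show T: "?T \<in> sets P" by simp
  have "emeasure P ?T = (\<integral>\<^sup>+p. indicator ?T p \<partial>P)" using T by simp
  also have "\<dots> \<le> (\<integral>\<^sup>+p. weight F L t p \<partial>P)"
    by (intro nn_integral_mono) (auto simp: weight_def indicator_def)
  also note nn_integral_weight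
  finally show "measure P ?T \<le> (\<Prod>B\<leftarrow>L. prob (holds B)) * prob F"
    by (subst (asm) run.emeasure_eq_measure, subst (asm) ennreal_le_iff)
      (auto intro!: mult_nonneg_nonneg prod_list_nonneg)
qed

end

text \<open>The law of the state is absolutely continuous with respect to \<open>\<Omega>\<close>:
  the state is reached by the word of its own log, only finitely many words are possible up to time
  \<open>t\<close>, and \<open>tracked_prob\<close> gives each of them probability 0 of ending in
  \<open>N\<close>.\<close>

lemma state_null:
  assumes [measurable]: "N \<in> events" and "prob N = 0"
  shows "{p \<in> space P. state t p \<in> N} \<in> null_sets P"
proof -
  let ?Ls = "{L. set L \<subseteq> \<B> \<and> length L \<le> t}"
  have "finite ?Ls" by (rule finite_lists_length_le[OF finite_bad])
  moreover have "{p \<in> space P. \<exists>z\<in>N. tracked L t p = Some ([], z)} \<in> null_sets P" if "L \<in> ?Ls" for L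
  proof -
    have ev: "\<forall>B\<in>set L. is_event n M B" using that bad_event by auto
    show ?thesis
      using tracked_prob[OF assms(1) ev, of t] assms(2)
      by (auto simp: null_sets_def run.emeasure_eq_measure measure_le_0_iff)
  qed
  ultimately have "(\<Union>L\<in>?Ls. {p \<in> space P. \<exists>z\<in>N. tracked L t p = Some ([], z)}) \<in> null_sets P"
    by (intro null_sets_UN') (auto intro: countable_finite)
  moreover have "{p \<in> space P. state t p \<in> N} \<subseteq> (\<Union>L\<in>?Ls. {p \<in> space P. \<exists>z\<in>N. tracked L t p = Some ([], z)})"
  proof
    fix p assume p: "p \<in> {p \<in> space P. state t p \<in> N}"
    then have "map fst (run_log t p) \<in> ?Ls"
      using run_log_sets(1)[of p t] length_run_log[of t p] by auto
    moreover have "tracked (map fst (run_log t p)) t p = Some ([], state t p)"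
      using track_self[of "run_log t p" "[]" "fst p 0"] by (simp add: exec_run_log)
    ultimately show "p \<in> (\<Union>L\<in>?Ls. {p \<in> space P. \<exists>z\<in>N. tracked L t p = Some ([], z)})"
      using p by blast
  qed
  moreover have "{p \<in> space P. state t p \<in> N} \<in> sets P" by measurable
  ultimately show ?thesis using null_sets_subset by blast
qed

end

subsection \<open>The bound for a union of events\<close>

lemma sum_set_le_sum_list:
  fixes f :: "'b \<Rightarrow> real"
  assumes "\<And>x. f x \<ge> 0"
  shows "(\<Sum>x\<in>set xs. f x) \<le> (\<Sum>x\<leftarrow>xs. f x)"
  by (induction xs) (auto simp: sum.insert_if assms intro: order_trans add_increasing)

context mt_run
begin

lemma run_log_chosen: "(B, y) \<in> set (run_log t p) \<Longrightarrow> \<exists>u<t. chosen u p = Some B"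
proof (induction t)
  case (Suc t)
  show ?case
  proof (cases "(B, y) \<in> set (run_log t p)")
    case True
    then show ?thesis using Suc.IH less_SucI by blast
  next
    case False
    then have "chosen t p = Some B" using Suc.prems by (auto split: option.splits)
    then show ?thesis by blast
  qed
qed simp

context
  fixes \<A> :: "'a event set" and E C
  assumes shearer: "shearer \<Omega> \<B>"
    and \<A>: "finite \<A>" "\<A> \<noteq> {}" "\<And>A. A \<in> \<A> \<Longrightarrow> is_event n M A"
  defines E: "E \<equiv> (\<Union>A\<in>\<A>. holds A)" and C: "C \<equiv> bad_cond \<Omega> \<B> E"
begin

lemma events_target [measurable]: "E \<in> events"
  unfolding E using \<A>(1) is_event_holds(1)[OF \<A>(3)] by auto

lemma bad_related_self: "B \<in> \<B> \<Longrightarrow> related B B"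
  using shearer_related_self[OF finite_bad shearer prob_space_axioms] is_event_holds[OF bad_event] by metis

lemma not_bad_cond_null:
  assumes "B \<in> \<B>" "B \<notin> C"
  shows "prob (holds B - E) = 0"
proof -
  have B [measurable]: "holds B \<in> events" by (rule is_event_holds(1)[OF bad_event[OF assms(1)]])
  have sp: "holds B \<subseteq> space \<Omega>" "E \<subseteq> space \<Omega>"
    using sets.sets_into_space[OF B] sets.sets_into_space[OF events_target] .
  then have eqs: "{x \<in> space \<Omega>. x \<in> E \<and> x \<in> holds B} = holds B \<inter> E"
    "{x \<in> space \<Omega>. x \<in> holds B} = holds B" by auto
  have "1 \<le> prob (holds B \<inter> E) / prob (holds B)"
    using assms unfolding C bad_cond_def cond_prob_def by (auto simp: eqs)
  then have "prob (holds B) \<le> prob (holds B \<inter> E)"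
    by (cases "prob (holds B) = 0") (auto simp: divide_simps zero_less_measure_iff split: if_splits)
  moreover have "prob (holds B - E) = prob (holds B) - prob (holds B \<inter> E)"
    using finite_measure_Diff'[of "holds B" E] by simp
  ultimately show ?thesis using measure_nonneg[of \<Omega> "holds B - E"] by linarith
qed

text \<open>The horizon \<open>T\<close> bounds the length of the words, so the union bound is
  finite, while the resulting estimate is free of \<open>T\<close>.\<close>

lemma reach_prob:
  "measure P {p \<in> space P. \<exists>t\<le>T. state t p \<in> E} \<le> prob E * (MAX A\<in>\<A>. \<Psi> \<Omega> C A)"
proof -
  have finC: "finite C" "C \<subseteq> \<B>"
    using finite_bad by (auto simp: C bad_cond_def)
  obtain Cs where Cs: "set Cs = C" "distinct Cs"
    using finite_distinct_list[OF finC(1)] by blast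
  obtain A :: "nat \<Rightarrow> 'a event" and m where A: "bij_betw A {0..<m} \<A>"
    using ex_bij_betw_nat_finite[OF \<A>(1)] by blast
  then have A_in: "A i \<in> \<A>" if "i < m" for i
    using that by (auto simp: bij_betw_def)
  have A_img: "\<A> = A ` {0..<m}" using A by (auto simp: bij_betw_def)
  have A_sets: "holds (A i) \<in> events" if "i < m" for i
    by (rule is_event_holds(1)[OF \<A>(3)[OF A_in[OF that]]])
  \<comment> \<open>\<open>F i\<close> is the part of \<open>E\<close> where \<open>A i\<close> is
    the first target to hold. Disjointness makes the probabilities add up to \<open>prob E\<close>
    at the end.\<close>
  define F where "F = disjointed (\<lambda>i. if i < m then holds (A i) else {})"
  have F_sub: "F i \<subseteq> holds (A i)" if "i < m" for i
    using disjointed_subset[of "\<lambda>i. if i < m then holds (A i) else {}" i] that by (simp add: F_def)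
  have F_Un: "(\<Union>i\<in>{0..<m}. F i) = E"
    unfolding F_def finite_UN_disjointed_eq E A_img by auto
  have F_sets: "F i \<in> events" for i
    using sets.range_disjointed_sets[of "\<lambda>i. if i < m then holds (A i) else {}" \<Omega>] A_sets
    unfolding F_def by auto
  let ?W = "\<lambda>i. canonical_words Cs T (filter (\<lambda>B. related B (A i)) Cs)"
  let ?G = "\<lambda>i L. {p \<in> space P. \<exists>z\<in>F i. tracked L T p = Some ([], z)}"
  let ?N = "\<Union>B\<in>\<B> - C. holds B - E"
  let ?Null = "\<Union>t<T. {p \<in> space P. state t p \<in> ?N}"
  have N: "?N \<in> null_sets \<Omega>"
    using finite_bad not_bad_cond_null is_event_holds(1)[OF bad_event]
    by (intro null_sets_UN') (auto simp: null_sets_def emeasure_eq_measure intro: countable_finite)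
  have Null: "?Null \<in> null_sets P"
    using N by (intro null_sets_UN' state_null) (auto simp: null_sets_def measure_def)
  have ev: "\<forall>B\<in>set L. is_event n M B" if "L \<in> set (?W i)" for L i
    using canonical_words_labels[OF that] Cs(1) finC(2) bad_event by auto
  have "{p \<in> space P. \<exists>t\<le>T. state t p \<in> E} \<subseteq> ?Null \<union> (\<Union>i\<in>{0..<m}. \<Union>L\<in>set (?W i). ?G i L)"
  proof
    fix p assume p: "p \<in> {p \<in> space P. \<exists>t\<le>T. state t p \<in> E}"
    then have pP: "p \<in> space P" by simp
    define t where "t = (LEAST t. state t p \<in> E)"
    have t: "state t p \<in> E" "\<And>u. u < t \<Longrightarrow> state u p \<notin> E" "t \<le> T"
      using p LeastI_ex[of "\<lambda>t. state t p \<in> E"] not_less_Least[of _ "\<lambda>t. state t p \<in> E"]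
      unfolding t_def by (blast intro: order_trans Least_le)+
    show "p \<in> ?Null \<union> (\<Union>i\<in>{0..<m}. \<Union>L\<in>set (?W i). ?G i L)"
    proof (cases "fst ` set (run_log t p) \<subseteq> C")
      case False
      then obtain B y where "(B, y) \<in> set (run_log t p)" "B \<notin> C"
        by (metis image_subsetI prod.collapse)
      then obtain u where u: "u < t" "chosen u p = Some B" using run_log_chosen by blast
      \<comment> \<open>Before the first visit to \<open>E\<close>, an event outside
        \<open>C\<close> was true.\<close>
      then have "state u p \<in> ?N"
        using chosen_Some[OF pP u(2)] t(2)[OF u(1)] \<open>B \<notin> C\<close> by auto
      then show ?thesis using pP u(1) t(3) by auto
    next
      case True
      obtain z where z: "z \<in> E"
        "\<And>A. \<lbrakk>A \<in> \<A>; z \<in> holds A\<rbrakk> \<Longrightarrow>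
          \<exists>L\<in>set (canonical_words Cs T (filter (\<lambda>B. related B A) Cs)). tracked L t p = Some ([], z)"
      proof (rule subrun_canonical_word[of Cs "run_log t p" T "fst p 0" E \<A> "space \<Omega>"])
        show "fst ` set (run_log t p) \<subseteq> set Cs" using True Cs(1) by simp
        show "length (run_log t p) \<le> T" using length_run_log[of t p] t(3) by simp
        show "exec (fst p 0) (run_log t p) \<in> E" using t(1) by (simp add: exec_run_log)
        fix A z z' assume "A \<in> \<A>" "z \<in> space \<Omega>" "z' \<in> space \<Omega>" "\<forall>i\<in>var A. z i = z' i" "z \<in> holds A"
        then show "z' \<in> E" using is_event_holds(3)[OF \<A>(3), of A z z'] unfolding E by blast
      qed (use Cs(1) finC(2) bad_related_self resample_in_space sample_in_space[OF pP] run_log_sets(2)[OF pP] in auto)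
      obtain i where i: "i < m" "z \<in> F i" using z(1) F_Un by auto
      obtain L where L: "L \<in> set (?W i)" "tracked L t p = Some ([], z)"
        using z(2)[OF A_in[OF i(1)]] F_sub[OF i(1)] i(2) by auto
      \<comment> \<open>An exhausted word stays exhausted, so the random visiting time can be
        replaced by \<open>T\<close>.\<close>
      have "tracked L T p = Some ([], z)"
        using t(3)
      proof (induction T rule: dec_induct)
        case (step k)
        then show ?case by (auto simp: tracked_Suc simp del: run_log.simps split: option.split)
      qed (rule L(2))
      then show ?thesis using i L(1) pP by auto
    qed
  qed
  moreover have G: "(\<Union>i\<in>{0..<m}. \<Union>L\<in>set (?W i). ?G i L) \<in> sets P"
    using tracked_prob(1)[OF F_sets ev] by (intro sets.finite_UN) auto
  ultimately have "measure P {p \<in> space P. \<exists>t\<le>T. state t p \<in> E} \<le>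
      measure P (?Null \<union> (\<Union>i\<in>{0..<m}. \<Union>L\<in>set (?W i). ?G i L))"
    by (intro run.finite_measure_mono sets.Un null_setsD2[OF Null])
  also have "\<dots> \<le> measure P ?Null + measure P (\<Union>i\<in>{0..<m}. \<Union>L\<in>set (?W i). ?G i L)"
    by (rule measure_Un_le[OF null_setsD2[OF Null] G])
  also have "measure P ?Null = 0"
    using Null by (simp add: null_sets_def measure_def)
  also have "measure P (\<Union>i\<in>{0..<m}. \<Union>L\<in>set (?W i). ?G i L) \<le>
      (\<Sum>i\<in>{0..<m}. measure P (\<Union>L\<in>set (?W i). ?G i L))"
    using tracked_prob(1)[OF F_sets ev] by (intro run.finite_measure_subadditive_finite) auto
  also have "\<dots> \<le> (\<Sum>i\<in>{0..<m}. \<Psi> \<Omega> C (A i) * prob (F i))"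
  proof (rule sum_mono)
    fix i assume "i \<in> {0..<m}"
    have "measure P (\<Union>L\<in>set (?W i). ?G i L) \<le> (\<Sum>L\<in>set (?W i). measure P (?G i L))"
      using tracked_prob(1)[OF F_sets ev] by (intro run.finite_measure_subadditive_finite) auto
    also have "\<dots> \<le> (\<Sum>L\<in>set (?W i). (\<Prod>B\<leftarrow>L. prob (holds B)) * prob (F i))"
      using tracked_prob(2)[OF F_sets ev] by (intro sum_mono) auto
    also have "\<dots> = (\<Sum>L\<in>set (?W i). \<Prod>B\<leftarrow>L. prob (holds B)) * prob (F i)"
      by (simp add: sum_distrib_right)
    also have "\<dots> \<le> (\<Sum>L\<leftarrow>?W i. \<Prod>B\<leftarrow>L. prob (holds B)) * prob (F i)"
      by (intro mult_right_mono sum_set_le_sum_list prod_list_nonneg) auto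
    also have "\<dots> \<le> \<Psi> \<Omega> C (A i) * prob (F i)"
    proof (rule mult_right_mono)
      have "(\<Sum>L\<leftarrow>?W i. \<Prod>B\<leftarrow>L. prob (holds B)) \<le>
          Q \<Omega> (set Cs - set (filter (\<lambda>B. related B (A i)) Cs)) {} / Q \<Omega> (set Cs) {}"
        using Cs finC bad_related_self by (intro sum_canonical_words_le[OF finite_bad shearer]) auto
      also have "\<dots> = \<Psi> \<Omega> C (A i)"
        by (simp add: shearer_Psi_eq[OF finC(1)] Cs(1) nbhd_def)
      finally show "(\<Sum>L\<leftarrow>?W i. \<Prod>B\<leftarrow>L. prob (holds B)) \<le> \<Psi> \<Omega> C (A i)" .
    qed simp
    finally show "measure P (\<Union>L\<in>set (?W i). ?G i L) \<le> \<Psi> \<Omega> C (A i) * prob (F i)" .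
  qed
  also have "\<dots> \<le> (\<Sum>i\<in>{0..<m}. (MAX A\<in>\<A>. \<Psi> \<Omega> C A) * prob (F i))"
    using \<A>(1) A_in by (intro sum_mono mult_right_mono Max_ge) auto
  also have "\<dots> = (MAX A\<in>\<A>. \<Psi> \<Omega> C A) * prob (\<Union>i\<in>{0..<m}. F i)"
    using F_sets disjoint_family_disjointed
    by (subst finite_measure_finite_Union)
      (auto simp: sum_distrib_left F_def intro: disjoint_family_on_mono[of _ UNIV])
  finally show ?thesis by (simp add: F_Un mult.commute)
qed

text \<open>Terminating in \<open>E\<close> is a visit to \<open>E\<close>; the events of a visit by
  time \<open>T\<close> increase with \<open>T\<close>, so the uniform bound passes to the
  limit.\<close>

lemma mt_prob_le: "mt_prob \<Omega> \<B> S sel E \<le> prob E * (MAX A\<in>\<A>. \<Psi> \<Omega> C A)"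
proof -
  let ?X = "\<lambda>T. {p \<in> space P. \<exists>t\<le>T. state t p \<in> E}"
  have X: "?X T \<in> sets P" for T by measurable
  have "mt_prob \<Omega> \<B> S sel E \<le> measure P (\<Union>T. ?X T)"
    unfolding mt_prob_def mt_state_eq
    using X by (intro run.finite_measure_mono) auto
  also have "(\<lambda>T. measure P (?X T)) \<longlonglongrightarrow> measure P (\<Union>T. ?X T)"
    using X by (intro run.finite_Lim_measure_incseq incseq_SucI) (auto intro: le_SucI)
  then have "measure P (\<Union>T. ?X T) \<le> prob E * (MAX A\<in>\<A>. \<Psi> \<Omega> C A)"
    by (rule LIMSEQ_le_const2) (intro exI allI impI reach_prob)
  finally show ?thesis .
qed

end

end

theorem corollary3p5:
  fixes n :: nat
    and M :: "nat \<Rightarrow> 'a measure"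
    and \<Omega> :: "'a config measure"
    and \<B> \<A> :: "'a event set"
    and S :: "'s measure"
    and sel :: "('s, 'a) rule"
  assumes "\<And>i. i \<in> {1..n} \<Longrightarrow> prob_space (M i)"
    and "\<Omega> = prod_space n M"
    and "finite \<B>" and "\<And>B. B \<in> \<B> \<Longrightarrow> is_event n M B"
    and "shearer \<Omega> \<B>"
    and "prob_space S" and "selection_rule \<Omega> \<B> S sel"
    and "finite \<A>" and "\<A> \<noteq> {}" and "\<And>A. A \<in> \<A> \<Longrightarrow> is_event n M A"
  shows "mt_prob \<Omega> \<B> S sel (\<Union>A\<in>\<A>. holds A)
           \<le> measure \<Omega> (\<Union>A\<in>\<A>. holds A)
              * (MAX A\<in>\<A>. \<Psi> \<Omega> (bad_cond \<Omega> \<B> (\<Union>A'\<in>\<A>. holds A')) A)"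
proof -
  \<comment> \<open>Library product spaces need a probability space at every index, even outside the product.\<close>
  define M' where "M' i = (if i \<in> {1..n} then M i else return (count_space UNIV) undefined)" for i
  have \<Omega>: "\<Omega> = prod_space n M'"
    unfolding assms(2) prod_space_def by (rule PiM_cong) (auto simp: M'_def)
  have event: "is_event n M' B" if "is_event n M B" for B
    using that unfolding is_event_def \<Omega>[unfolded assms(2)] .
  interpret S: prob_space S by fact
  have prob: "prob_space (M' i)" for i
    using assms(1) by (auto simp: M'_def intro: prob_space_return)
  interpret mt_run n M' S \<B> sel
    by (intro mt_run.intro variable_space.intro mt_run_axioms.intro)
      (fact prob assms(6) assms(3) event[OF assms(4)] assms(7)[unfolded \<Omega>])+
  show ?thesis
    unfolding \<Omega> using mt_prob_le[OF assms(5)[unfolded \<Omega>] assms(8,9) event[OF assms(10)]] .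
qed

end
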